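(* Let $0\le\mathfrak a<\mathfrak b$, $\mathfrak c\ge0$, $\kappa=(0,\kappa_2,\kappa_3)$ with $\kappa_2>-\frac12$, $\kappa_3>-1$. Define, for $v\neq0$, $$\mathfrak D=(1-u^2)\partial_{uu}-2(v^2-\mathfrak c)\frac uv\partial_{uv}+\Big[\mathfrak a+\mathfrak b-v^2+\frac{-\mathfrak a\mathfrak b+(\mathfrak a-\mathfrak c)(\mathfrak b-\mathfrak c)u^2}{v^2}\Big]\partial_{vv}+\Big[\mathfrak c-2\mathfrak a-\frac{-\mathfrak a\mathfrak b+(\mathfrak a-\mathfrak c)(\mathfrak b-\mathfrak c)u^2}{v^2}\Big]\frac1v\partial_v-(2\kappa_2+2\kappa_3+3)\Big[u\partial_u+\frac{v^2-\mathfrak a}{v}\partial_v\Big]+2\kappa_2(\mathfrak b-\mathfrak a)\frac1v\partial_v.$$ Then every $Y\in\mathcal V^{\circ,\mathsf E}_n(\mathsf W^\kappa_{\mathfrak a,\mathfrak b,\mathfrak c},\Omega_{\mathfrak a,\mathfrak b,\mathfrak c})$ satisfies $\mathfrak D Y=-n(n+2\kappa_2+2\kappa_3+2)Y$ on $\Omega_{\mathfrak a,\mathfrak b,\mathfrak c}$ (at points with $v\ne0$). Moreover, for every twice continuously differentiable $f$ on the interior of the upper half disk, $\mathfrak D(f\circ\psi)=(\mathcal D f)\circ\psi$ on the interior of $\Lambda_{\mathfrak a,\mathfrak b,\mathfrak c}$, where $$\mathcal D=(1-s^2)\partial_{ss}-2st\partial_{st}+(1-t^2)\partial_{tt}-(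2\kappa_2+2\kappa_3+3)(s\partial_s+t\partial_t)+\frac{2\kappa_2}{t}\partial_t.$$
   Context: $\Omega_{\mathfrak a,\mathfrak b,\mathfrak c}=\{(u,v):|u|\le1,\ \mathfrak a+(\mathfrak c-\mathfrak a)u^2\le v^2\le\mathfrak b+(\mathfrak c-\mathfrak b)u^2\}$, $\Lambda_{\mathfrak a,\mathfrak b,\mathfrak c}=\{(u,v)\in\Omega_{\mathfrak a,\mathfrak b,\mathfrak c}:v\ge0\}$, weight $\mathsf W^\kappa_{\mathfrak a,\mathfrak b,\mathfrak c}(u,v)=|v|\Big(\frac{-\mathfrak a+(\mathfrak a-\mathfrak c)u^2+v^2}{\mathfrak b-\mathfrak a}\Big)^{\kappa_2-\frac12}\Big(\frac{\mathfrak b-(\mathfrak b-\mathfrak c)u^2-v^2}{\mathfrak b-\mathfrak a}\Big)^{\kappa_3}$ (the case $\kappa_1=0$). $\mathcal V^{\circ,\mathsf E}_n(\mathsf W,\Omega)$ is the space of polynomials of degree $n$, even in the second variable, orthogonal in $L^2(\mathsf W,\Omega)$ to all polynomials of lower degree. $\psi(u,v)=(u,\mathfrak t(u,v))$ with $\mathfrak t(u,v)=\sqrt{\frac{-\mathfrak a+(\mathfrak a-\mathfrak c)u^2+v^2}{\mathfrak b-\mathfrak a}}$, mapping $\Lambda_{\mathfrak a,\mathfrak b,\mathfrak c}$ onto $\{(s,t):s^2+t^2\le1,t\ge0\}$. *)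

theory Defs
  imports "HOL-Analysis.Analysis"
begin

definition pdu :: "(real \<times> real \<Rightarrow> real) \<Rightarrow> real \<times> real \<Rightarrow> real" where
  "pdu g p = deriv (\<lambda>x. g (x, snd p)) (fst p)"

definition pdv :: "(real \<times> real \<Rightarrow> real) \<Rightarrow> real \<times> real \<Rightarrow> real" where
  "pdv g p = deriv (\<lambda>y. g (fst p, y)) (snd p)"

definition has_partials_on :: "(real \<times> real) set \<Rightarrow> (real \<times> real \<Rightarrow> real) \<Rightarrow> bool" where
  "has_partials_on S g \<longleftrightarrow> continuous_on S g \<and>
     (\<forall>p\<in>S. (\<lambda>x. g (x, snd p)) field_differentiable (at (fst p)) \<and>
            (\<lambda>y. g (fst p, y)) field_differentiable (at (snd p)))"

definition C2_on :: "(real \<times> real) set \<Rightarrow> (real \<times> real \<Rightarrow> real) \<Rightarrow> bool" where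
  "C2_on S f \<longleftrightarrow> has_partials_on S f \<and> has_partials_on S (pdu f) \<and> has_partials_on S (pdv f) \<and>
     continuous_on S (pdu (pdu f)) \<and> continuous_on S (pdv (pdu f)) \<and>
     continuous_on S (pdu (pdv f)) \<and> continuous_on S (pdv (pdv f))"

definition poly2_le :: "nat \<Rightarrow> (real \<times> real \<Rightarrow> real) \<Rightarrow> bool" where
  "poly2_le n P \<longleftrightarrow> (\<exists>c :: nat \<Rightarrow> nat \<Rightarrow> real. (\<forall>i j. n < i + j \<longrightarrow> c i j = 0) \<and>
     (\<forall>u v. P (u, v) = (\<Sum>i\<le>n. \<Sum>j\<le>n. c i j * u ^ i * v ^ j)))"

definition Omega :: "real \<Rightarrow> real \<Rightarrow> real \<Rightarrow> (real \<times> real) set" where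
  "Omega a b c = {(u, v). \<bar>u\<bar> \<le> 1 \<and> a + (c - a) * u\<^sup>2 \<le> v\<^sup>2 \<and> v\<^sup>2 \<le> b + (c - b) * u\<^sup>2}"

definition Lambda :: "real \<Rightarrow> real \<Rightarrow> real \<Rightarrow> (real \<times> real) set" where
  "Lambda a b c = {(u, v) \<in> Omega a b c. v \<ge> 0}"

text \<open>The weight W^kappa_{a,b,c} with kappa_1 = 0.\<close>
definition Wt :: "real \<Rightarrow> real \<Rightarrow> real \<Rightarrow> real \<Rightarrow> real \<Rightarrow> real \<times> real \<Rightarrow> real" where
  "Wt a b c k2 k3 p = (case p of (u, v) \<Rightarrow>
     \<bar>v\<bar> * ((- a + (a - c) * u\<^sup>2 + v\<^sup>2) / (b - a)) powr (k2 - 1/2)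
         * ((b - (b - c) * u\<^sup>2 - v\<^sup>2) / (b - a)) powr k3)"

definition VE :: "real \<Rightarrow> real \<Rightarrow> real \<Rightarrow> real \<Rightarrow> real \<Rightarrow> nat \<Rightarrow> (real \<times> real \<Rightarrow> real) set" where
  "VE a b c k2 k3 n = {Y. poly2_le n Y \<and> (\<forall>u v. Y (u, - v) = Y (u, v)) \<and>
     (\<forall>Q. (0 < n \<and> poly2_le (n - 1) Q) \<longrightarrow>
        integral (Omega a b c) (\<lambda>p. Wt a b c k2 k3 p * Y p * Q p) = 0)}"

definition tfun :: "real \<Rightarrow> real \<Rightarrow> real \<Rightarrow> real \<times> real \<Rightarrow> real" where
  "tfun a b c p = (case p of (u, v) \<Rightarrow> sqrt ((- a + (a - c) * u\<^sup>2 + v\<^sup>2) / (b - a)))"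

definition psi :: "real \<Rightarrow> real \<Rightarrow> real \<Rightarrow> real \<times> real \<Rightarrow> real \<times> real" where
  "psi a b c p = (fst p, tfun a b c p)"

definition upper_half_disk :: "(real \<times> real) set" where
  "upper_half_disk = {(s, t). s\<^sup>2 + t\<^sup>2 \<le> 1 \<and> t \<ge> 0}"

definition Dfrak :: "real \<Rightarrow> real \<Rightarrow> real \<Rightarrow> real \<Rightarrow> real \<Rightarrow> (real \<times> real \<Rightarrow> real) \<Rightarrow> real \<times> real \<Rightarrow> real" where
  "Dfrak a b c k2 k3 Y p = (case p of (u, v) \<Rightarrow>
      (1 - u\<^sup>2) * pdu (pdu Y) p
    - 2 * (v\<^sup>2 - c) * (u / v) * pdv (pdu Y) p
    + (a + b - v\<^sup>2 + (- a * b + (a - c) * (b - c) * u\<^sup>2) / v\<^sup>2) * pdv (pdv Y) p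
    + (c - 2 * a - (- a * b + (a - c) * (b - c) * u\<^sup>2) / v\<^sup>2) * (1 / v) * pdv Y p
    - (2 * k2 + 2 * k3 + 3) * (u * pdu Y p + ((v\<^sup>2 - a) / v) * pdv Y p)
    + 2 * k2 * (b - a) * (1 / v) * pdv Y p)"

definition Dcal :: "real \<Rightarrow> real \<Rightarrow> (real \<times> real \<Rightarrow> real) \<Rightarrow> real \<times> real \<Rightarrow> real" where
  "Dcal k2 k3 f q = (case q of (s, t) \<Rightarrow>
      (1 - s\<^sup>2) * pdu (pdu f) q - 2 * s * t * pdv (pdu f) q + (1 - t\<^sup>2) * pdv (pdv f) q
    - (2 * k2 + 2 * k3 + 3) * (s * pdu f q + t * pdv f q)
    + (2 * k2 / t) * pdv f q)"

end

theory Submission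
  imports Defs
begin

text \<open>Write \<open>x = t\<^sup>2\<close>. The change of variables \<open>(u, v) \<mapsto> (u, x)\<close> identifies the polynomials of degree \<open>n\<close>
  that are even in \<open>v\<close> with the polynomials in \<open>(s, x)\<close> of weighted degree \<open>n\<close>, where \<open>x\<close> has weight 2, and
  the chain rule turns \<open>Dfrak\<close> into the operator \<open>Dcal\<close>, rewritten in \<open>(s, x)\<close>. That operator maps \<open>s\<^sup>i x\<^sup>j\<close> to
  \<open>-m (m + 2 k2 + 2 k3 + 2) s\<^sup>i x\<^sup>j\<close> with \<open>m = i + 2 j\<close>, up to terms of lower degree, and it is symmetric for
  the transported weight: on monomials the symmetry is an identity between moments, which are products of two
  Beta functions. If \<open>Y\<close> is orthogonal to lower degrees and \<open>R = Dfrak Y + n (n + 2 k2 + 2 k3 + 2) Y\<close>, then \<open>R\<close> has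
  degree less than \<open>n\<close>, and by symmetry the integral of \<open>R\<^sup>2\<close> is a pairing of \<open>Y\<close> with a polynomial of degree
  less than \<open>n\<close>. Hence it vanishes, and \<open>R = 0\<close>.\<close>

section \<open>Mixed partial derivatives and the chain rule\<close>

text \<open>The mean value theorem is used twice: in \<open>x\<close> for
  \<open>F x (b+h) - F x b\<close>, then in \<open>y\<close> for \<open>Fx x\<close>. Exchanging the
  variables leaves the second difference unchanged, which links the two mixed partials.\<close>

lemma second_difference_mvt:
  fixes F Fx Fxy :: "real \<Rightarrow> real \<Rightarrow> real"
  assumes h: "0 < h"
    and Fx: "\<And>x y. x \<in> {a..a+h} \<Longrightarrow> y \<in> {b..b+h} \<Longrightarrow> ((\<lambda>x. F x y) has_real_derivative Fx x y) (at x)"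
    and Fxy: "\<And>x y. x \<in> {a..a+h} \<Longrightarrow> y \<in> {b..b+h} \<Longrightarrow> ((\<lambda>y. Fx x y) has_real_derivative Fxy x y) (at y)"
  obtains x y where "x \<in> {a..a+h}" "y \<in> {b..b+h}"
    "F (a+h) (b+h) - F (a+h) b - F a (b+h) + F a b = h\<^sup>2 * Fxy x y"
proof -
  have "\<exists>x. a < x \<and> x < a + h \<and>
      (F (a+h) (b+h) - F (a+h) b) - (F a (b+h) - F a b) = (a + h - a) * (Fx x (b+h) - Fx x b)"
    using h by (intro MVT2) (auto intro!: derivative_eq_intros Fx)
  then obtain x where x: "a < x" "x < a + h"
    "(F (a+h) (b+h) - F (a+h) b) - (F a (b+h) - F a b) = h * (Fx x (b+h) - Fx x b)" by auto
  have "\<exists>y. b < y \<and> y < b + h \<and> Fx x (b+h) - Fx x b = (b + h - b) * Fxy x y"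
    using h x by (intro MVT2) (auto intro!: Fxy)
  then obtain y where y: "b < y" "y < b + h" "Fx x (b+h) - Fx x b = h * Fxy x y" by auto
  show ?thesis
    using x y by (intro that[of x y]) (auto simp: power2_eq_square algebra_simps)
qed

text \<open>Schwarz's theorem. The second difference over a small square, divided by
  \<open>h^2\<close>, is a value of \<open>Fxy\<close> and also a value of \<open>Fyx\<close> in
  that square; continuity at the corner then rules out different values there.\<close>

lemma mixed_partials_eq:
  fixes F Fx Fy Fxy Fyx :: "real \<Rightarrow> real \<Rightarrow> real"
  assumes V: "open V" "(a, b) \<in> V"
    and Fx: "\<And>x y. (x, y) \<in> V \<Longrightarrow> ((\<lambda>x. F x y) has_real_derivative Fx x y) (at x)"
    and Fy: "\<And>x y. (x, y) \<in> V \<Longrightarrow> ((\<lambda>y. F x y) has_real_derivative Fy x y) (at y)"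
    and Fxy: "\<And>x y. (x, y) \<in> V \<Longrightarrow> ((\<lambda>y. Fx x y) has_real_derivative Fxy x y) (at y)"
    and Fyx: "\<And>x y. (x, y) \<in> V \<Longrightarrow> ((\<lambda>x. Fy x y) has_real_derivative Fyx x y) (at x)"
    and cxy: "continuous_on V (\<lambda>(x, y). Fxy x y)"
    and cyx: "continuous_on V (\<lambda>(x, y). Fyx x y)"
  shows "Fxy a b = Fyx a b"
proof (rule ccontr)
  assume ne: "Fxy a b \<noteq> Fyx a b"
  \<comment> \<open>Half the gap: numbers within less than \<open>e\<close> of
    \<open>Fxy a b\<close> and of \<open>Fyx a b\<close> cannot coincide.\<close>
  define e where "e = \<bar>Fxy a b - Fyx a b\<bar> / 2"
  have e: "e > 0" using ne by (simp add: e_def)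
  from cxy V e obtain d1 where d1: "d1 > 0"
    "\<And>p. p \<in> V \<Longrightarrow> dist p (a, b) < d1 \<Longrightarrow> dist (case p of (x, y) \<Rightarrow> Fxy x y) (Fxy a b) < e"
    unfolding continuous_on_iff by (metis case_prod_conv)
  from cyx V e obtain d2 where d2: "d2 > 0"
    "\<And>p. p \<in> V \<Longrightarrow> dist p (a, b) < d2 \<Longrightarrow> dist (case p of (x, y) \<Rightarrow> Fyx x y) (Fyx a b) < e"
    unfolding continuous_on_iff by (metis case_prod_conv)
  from V obtain d3 where d3: "d3 > 0" "\<And>p. dist p (a, b) < d3 \<Longrightarrow> p \<in> V"
    unfolding open_dist by metis
  \<comment> \<open>Points of the square are within \<open>2 * h\<close> of its corner, so a third
    of the least radius is small enough.\<close>
  define h where "h = min d1 (min d2 d3) / 3"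
  have h: "h > 0" "2 * h < d1" "2 * h < d2" "2 * h < d3"
    using d1 d2 d3 by (auto simp: h_def min_def)
  have near: "dist (x, y) (a, b) \<le> 2 * h" if "x \<in> {a..a+h}" "y \<in> {b..b+h}" for x y
  proof -
    have "dist (x, y) (a, b) \<le> dist x a + dist y b"
      unfolding dist_Pair_Pair by (rule sqrt_sum_squares_le_sum) auto
    then show ?thesis using that by (auto simp: dist_real_def)
  qed
  have inV: "(x, y) \<in> V" if "x \<in> {a..a+h}" "y \<in> {b..b+h}" for x y
    using near[OF that] h d3 by (meson le_less_trans)
  obtain x y where 1: "x \<in> {a..a+h}" "y \<in> {b..b+h}"
    "F (a+h) (b+h) - F (a+h) b - F a (b+h) + F a b = h\<^sup>2 * Fxy x y"
    using second_difference_mvt[of h a b F Fx Fxy] h Fx Fxy inV by blast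
  obtain y' x' where 2: "y' \<in> {b..b+h}" "x' \<in> {a..a+h}"
    "F (a+h) (b+h) - F a (b+h) - F (a+h) b + F a b = h\<^sup>2 * Fyx x' y'"
    using second_difference_mvt[of h b a "\<lambda>y x. F x y" "\<lambda>y x. Fy x y" "\<lambda>y x. Fyx x y"] h Fy Fyx inV by blast
  have "h\<^sup>2 * Fxy x y = h\<^sup>2 * Fyx x' y'" using 1(3) 2(3) by linarith
  then have eq: "Fxy x y = Fyx x' y'" using h by simp
  have "dist (Fxy x y) (Fxy a b) < e"
    using d1(2)[of "(x, y)"] inV near 1 h by fastforce
  moreover have "dist (Fyx x' y') (Fyx a b) < e"
    using d2(2)[of "(x', y')"] inV near 2 h by fastforce
  ultimately show False using eq by (auto simp: dist_real_def e_def abs_if split: if_splits)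
qed

lemma has_partials_onD:
  assumes "has_partials_on V f" "(x, y) \<in> V"
  shows "((\<lambda>x. f (x, y)) has_real_derivative pdu f (x, y)) (at x)"
    and "((\<lambda>y. f (x, y)) has_real_derivative pdv f (x, y)) (at y)"
  using assms unfolding has_partials_on_def pdu_def pdv_def
  by (force simp: DERIV_deriv_iff_field_differentiable)+

lemma C2_on_mixed_partials_eq:
  assumes "C2_on V f" "open V" "p \<in> V"
  shows "pdu (pdv f) p = pdv (pdu f) p"
proof -
  obtain a b where p: "p = (a, b)" by (cases p)
  have "pdv (pdu f) (a, b) = pdu (pdv f) (a, b)"
    using assms unfolding p C2_on_def
    by (intro mixed_partials_eq[where V = V and F = "\<lambda>x y. f (x, y)" and Fx = "\<lambda>x y. pdu f (x, y)"
          and Fy = "\<lambda>x y. pdv f (x, y)" and Fxy = "\<lambda>x y. pdv (pdu f) (x, y)" and Fyx = "\<lambda>x y. pdu (pdv f) (x, y)"])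
      (auto intro: has_partials_onD)
  then show ?thesis by (simp add: p)
qed

text \<open>Existence of both partials together with continuity of one of them,
  \<open>pdv g\<close>, gives total differentiability at the point; composing with
  \<open>x \<mapsto> (x, T x)\<close> gives the formula.\<close>

lemma has_partials_on_graph_derivative:
  assumes V: "open V" "(u, T u) \<in> V" and g: "has_partials_on V g"
    and cont: "continuous_on V (pdv g)"
    and T: "(T has_real_derivative T') (at u)"
  shows "((\<lambda>x. g (x, T x)) has_real_derivative pdu g (u, T u) + pdv g (u, T u) * T') (at u)"
proof -
  obtain A B where AB: "open A" "open B" "u \<in> A" "T u \<in> B" "A \<times> B \<subseteq> V"
    using V by (rule open_prod_elim) auto
  \<comment> \<open>A ball replaces \<open>B\<close> because the criterion via partials asks for a
    convex set in the second variable.\<close>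
  obtain e where e: "e > 0" "ball (T u) e \<subseteq> B" using AB openE by blast
  define Y where "Y = ball (T u) e"
  have sub: "A \<times> Y \<subseteq> V" using AB e by (auto simp: Y_def)
  have "((\<lambda>(x, y). g (x, y)) has_derivative (\<lambda>(tx, ty). pdu g (u, T u) * tx + blinfun_mult_right (pdv g (u, T u)) ty))
     (at (u, T u) within A \<times> Y)"
  proof (rule has_derivative_partialsI[where fy = "\<lambda>x y. blinfun_mult_right (pdv g (x, y))"])
    show "((\<lambda>x. g (x, T u)) has_derivative (*) (pdu g (u, T u))) (at u within A)"
      using has_partials_onD(1)[OF g V(2)] has_derivative_at_withinI by (auto simp: has_field_derivative_def)
    show "((\<lambda>y. g (x, y)) has_derivative blinfun_apply (blinfun_mult_right (pdv g (x, y)))) (at y within Y)"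
      if "x \<in> A" "y \<in> Y" for x y
      using has_partials_onD(2)[OF g, of x y] sub that
      by (auto simp: has_field_derivative_def intro: has_derivative_at_withinI)
    have "continuous_on (A \<times> Y) (\<lambda>(x, y). blinfun_mult_right (pdv g (x, y)))"
      unfolding split_beta prod.collapse
      by (intro bounded_linear.continuous_on[OF bounded_linear_blinfun_mult_right] continuous_on_subset[OF cont] sub)
    then show "continuous (at (u, T u) within A \<times> Y) (\<lambda>(x, y). blinfun_mult_right (pdv g (x, y)))"
      using AB e unfolding continuous_on_eq_continuous_within Y_def by (metis SigmaI centre_in_ball)
  qed (use e in \<open>auto simp: Y_def\<close>)
  then have D: "(g has_derivative (\<lambda>(tx, ty). pdu g (u, T u) * tx + pdv g (u, T u) * ty)) (at (u, T u))"
    using AB e by (subst (asm) at_within_open) (auto simp: Y_def intro: open_Times)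
  have "((\<lambda>x. (x, T x)) has_derivative (\<lambda>h. (h, T' * h))) (at u)"
    using T by (auto simp: has_field_derivative_def intro!: derivative_eq_intros)
  from has_derivative_compose[OF this D]
  have "((\<lambda>x. g (x, T x)) has_derivative (\<lambda>h. pdu g (u, T u) * h + pdv g (u, T u) * (T' * h))) (at u)"
    by simp
  also have "(\<lambda>h. pdu g (u, T u) * h + pdv g (u, T u) * (T' * h)) = (*) (pdu g (u, T u) + pdv g (u, T u) * T')"
    by (auto simp: algebra_simps)
  finally show ?thesis by (simp add: has_field_derivative_def)
qed

text \<open>\<open>T\<close> is kept abstract because the rule serves two maps that fix the first
  coordinate: \<open>T = xi\<close> with polynomials and \<open>T = sqrt xi\<close> with arbitrary
  C2 functions.\<close>

lemma second_order_chain_rule_graph: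
  fixes f :: "real \<times> real \<Rightarrow> real" and T Tu Tv Tuu Tuv Tvv :: "real \<times> real \<Rightarrow> real"
  assumes V: "open V" "C2_on V f" and U: "open U" "\<forall>p\<in>U. (fst p, T p) \<in> V"
    and Tu: "\<forall>p\<in>U. ((\<lambda>x. T (x, snd p)) has_real_derivative Tu p) (at (fst p))"
    and Tv: "\<forall>p\<in>U. ((\<lambda>y. T (fst p, y)) has_real_derivative Tv p) (at (snd p))"
    and Tuu: "\<forall>p\<in>U. ((\<lambda>x. Tu (x, snd p)) has_real_derivative Tuu p) (at (fst p))"
    and Tuv: "\<forall>p\<in>U. ((\<lambda>y. Tu (fst p, y)) has_real_derivative Tuv p) (at (snd p))"
    and Tvv: "\<forall>p\<in>U. ((\<lambda>y. Tv (fst p, y)) has_real_derivative Tvv p) (at (snd p))"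
    and p: "(u, v) \<in> U"
  defines "g \<equiv> \<lambda>p. f (fst p, T p)" and "q \<equiv> (u, T (u, v))"
  shows "pdu g (u, v) = pdu f q + pdv f q * Tu (u, v)" (is ?gu)
    and "pdv g (u, v) = pdv f q * Tv (u, v)" (is ?gv)
    and "pdu (pdu g) (u, v) = pdu (pdu f) q + 2 * pdv (pdu f) q * Tu (u, v)
           + pdv (pdv f) q * (Tu (u, v))\<^sup>2 + pdv f q * Tuu (u, v)" (is ?guu)
    and "pdv (pdu g) (u, v) = pdv (pdu f) q * Tv (u, v)
           + pdv (pdv f) q * (Tu (u, v) * Tv (u, v)) + pdv f q * Tuv (u, v)" (is ?guv)
    and "pdv (pdv g) (u, v) = pdv (pdv f) q * (Tv (u, v))\<^sup>2 + pdv f q * Tvv (u, v)" (is ?gvv)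
proof -
  have U2: "(x, T (x, y)) \<in> V" if "(x, y) \<in> U" for x y
    using U(2) that by force
  have Tu': "((\<lambda>x. T (x, y)) has_real_derivative Tu (x, y)) (at x)" if "(x, y) \<in> U" for x y
    using Tu that by force
  have Tv': "((\<lambda>y. T (x, y)) has_real_derivative Tv (x, y)) (at y)" if "(x, y) \<in> U" for x y
    using Tv that by force
  have Tuu': "((\<lambda>x. Tu (x, y)) has_real_derivative Tuu (x, y)) (at x)" if "(x, y) \<in> U" for x y
    using Tuu that by force
  have Tuv': "((\<lambda>y. Tu (x, y)) has_real_derivative Tuv (x, y)) (at y)" if "(x, y) \<in> U" for x y
    using Tuv that by force
  have Tvv': "((\<lambda>y. Tv (x, y)) has_real_derivative Tvv (x, y)) (at y)" if "(x, y) \<in> U" for x y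
    using Tvv that by force
  \<comment> \<open>The formulas for \<open>pdu g\<close> and \<open>pdv g\<close> hold on
    \<open>U\<close> only; differentiating them again needs neighbourhoods on the lines through
    \<open>(u, v)\<close>.\<close>
  have slice_u: "open {x. (x, v) \<in> U}"
    using open_vimage[OF U(1), of "\<lambda>x. (x, v)"]
    by (simp add: vimage_def continuous_on_Pair)
  have slice_v: "open {y. (u, y) \<in> U}"
    using open_vimage[OF U(1), of "\<lambda>y. (u, y)"]
    by (simp add: vimage_def continuous_on_Pair)
  note C2 = V(2)[unfolded C2_on_def]
  have du: "((\<lambda>x. h (x, T (x, y))) has_real_derivative pdu h (x, T (x, y)) + pdv h (x, T (x, y)) * Tu (x, y)) (at x)"
    if "has_partials_on V h" "continuous_on V (pdv h)" "(x, y) \<in> U" for h x y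
    using has_partials_on_graph_derivative[where T = "\<lambda>x. T (x, y)" and u = x] V that Tu' U2 by blast
  have dv: "((\<lambda>y. h (x, T (x, y))) has_real_derivative pdv h (x, T (x, y)) * Tv (x, y)) (at y)"
    if "has_partials_on V h" "(x, y) \<in> U" for h x y
    using DERIV_chain2[OF has_partials_onD(2) Tv'] that U2 by blast
  have cont: "continuous_on V (pdv f)"
    using C2 by (simp add: has_partials_on_def)
  have gu: "pdu g (x, y) = pdu f (x, T (x, y)) + pdv f (x, T (x, y)) * Tu (x, y)" if "(x, y) \<in> U" for x y
    using DERIV_imp_deriv[OF du[OF _ cont that]] C2 unfolding pdu_def[of g] unfolding g_def by simp
  have gv: "pdv g (x, y) = pdv f (x, T (x, y)) * Tv (x, y)" if "(x, y) \<in> U" for x y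
    using DERIV_imp_deriv[OF dv[OF _ that]] C2 unfolding pdv_def[of g] unfolding g_def by simp
  show ?gu ?gv using gu gv p by (simp_all add: q_def)
  \<comment> \<open>Differentiating \<open>pdv f * Tu\<close> in \<open>u\<close> produces the other
    mixed partial; identifying the two gives the coefficient 2 in \<open>?guu\<close>.\<close>
  have sym: "pdu (pdv f) q = pdv (pdu f) q"
    using C2_on_mixed_partials_eq[OF V(2,1)] U2[OF p] by (simp add: q_def)
  have "((\<lambda>x. pdu f (x, T (x, v)) + pdv f (x, T (x, v)) * Tu (x, v)) has_real_derivative
      (pdu (pdu f) q + pdv (pdu f) q * Tu (u, v)) +
      ((pdu (pdv f) q + pdv (pdv f) q * Tu (u, v)) * Tu (u, v) + Tuu (u, v) * pdv f q)) (at u)"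
    unfolding q_def using C2 p by (intro DERIV_add DERIV_mult du Tuu') auto
  then have "((\<lambda>x. pdu g (x, v)) has_real_derivative
      (pdu (pdu f) q + pdv (pdu f) q * Tu (u, v)) +
      ((pdu (pdv f) q + pdv (pdv f) q * Tu (u, v)) * Tu (u, v) + Tuu (u, v) * pdv f q)) (at u)"
    by (rule has_field_derivative_transform_within_open[OF _ slice_u]) (use p gu in auto)
  from DERIV_imp_deriv[OF this] sym show ?guu
    by (simp add: pdu_def[of "pdu g"] algebra_simps power2_eq_square)
  have "((\<lambda>y. pdu f (u, T (u, y)) + pdv f (u, T (u, y)) * Tu (u, y)) has_real_derivative
      pdv (pdu f) q * Tv (u, v) +
      (pdv (pdv f) q * Tv (u, v) * Tu (u, v) + Tuv (u, v) * pdv f q)) (at v)"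
    unfolding q_def using C2 p by (intro DERIV_add DERIV_mult dv Tuv') auto
  then have "((\<lambda>y. pdu g (u, y)) has_real_derivative
      pdv (pdu f) q * Tv (u, v) +
      (pdv (pdv f) q * Tv (u, v) * Tu (u, v) + Tuv (u, v) * pdv f q)) (at v)"
    by (rule has_field_derivative_transform_within_open[OF _ slice_v]) (use p gu in auto)
  from DERIV_imp_deriv[OF this] show ?guv
    by (simp add: pdv_def[of "pdu g"] algebra_simps)
  have "((\<lambda>y. pdv f (u, T (u, y)) * Tv (u, y)) has_real_derivative
      pdv (pdv f) q * Tv (u, v) * Tv (u, v) + Tvv (u, v) * pdv f q) (at v)"
    unfolding q_def using C2 p by (intro DERIV_mult dv Tvv') auto
  then have "((\<lambda>y. pdv g (u, y)) has_real_derivative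
      pdv (pdv f) q * Tv (u, v) * Tv (u, v) + Tvv (u, v) * pdv f q) (at v)"
    by (rule has_field_derivative_transform_within_open[OF _ slice_v]) (use p gv in auto)
  from DERIV_imp_deriv[OF this] show ?gvv
    by (simp add: pdv_def[of "pdv g"] algebra_simps power2_eq_square)
qed

section \<open>Weighted polynomials and the operator in the coordinates \<open>(s, t\<^sup>2)\<close>\<close>

text \<open>Polynomials in two variables in which the second variable has weight \<open>q\<close>: with \<open>q = 1\<close> this is
  the usual total degree, and \<open>q = 2\<close> is the degree in \<open>(s, t)\<close> of a polynomial in \<open>(s, t\<^sup>2)\<close>.\<close>

inductive wpol :: "nat \<Rightarrow> nat \<Rightarrow> (real \<times> real \<Rightarrow> real) \<Rightarrow> bool" for q n where
  monom: "i + q * j \<le> n \<Longrightarrow> wpol q n (\<lambda>p. c * fst p ^ i * snd p ^ j)"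
| add: "wpol q n G \<Longrightarrow> wpol q n H \<Longrightarrow> wpol q n (\<lambda>p. G p + H p)"

section \<open>Closure properties and calculus of weighted polynomials\<close>

lemma wpol_const: "wpol q n (\<lambda>p. c)"
  using wpol.monom[of 0 q 0 n c] by simp

lemma wpol_mono:
  assumes "wpol q m G" "m \<le> n"
  shows "wpol q n G"
  using assms by (induction) (auto intro: wpol.intros)

lemma wpol_sum:
  assumes "\<And>i. i \<in> A \<Longrightarrow> wpol q n (G i)"
  shows "wpol q n (\<lambda>p. \<Sum>i\<in>A. G i p)"
  using assms by (induction A rule: infinite_finite_induct) (auto intro: wpol_const wpol.add)

lemma wpol_mult:
  assumes "wpol q m G" "wpol q n H"
  shows "wpol q (m + n) (\<lambda>p. G p * H p)"
  using assms
proof (induction)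
  case (monom i j c)
  from monom(2,1) show ?case
  proof induction
    case (monom i' j' d)
    have "wpol q (m + n) (\<lambda>p. c * d * fst p ^ (i + i') * snd p ^ (j + j'))"
      using monom by (intro wpol.monom) (simp add: algebra_simps)
    then show ?case by (simp add: power_add mult_ac)
  qed (simp add: distrib_left wpol.add)
qed (simp add: distrib_right wpol.add)

lemma wpol_cmult: "wpol q n G \<Longrightarrow> wpol q n (\<lambda>p. c * G p)"
  using wpol_mult[OF wpol_const[of q 0 c]] by simp

lemma wpol_power:
  assumes "wpol q m G"
  shows "wpol q (k * m) (\<lambda>p. G p ^ k)"
  by (induction k) (auto simp: wpol_const intro: wpol_mult assms)

lemma wpol_field_differentiable:
  assumes "wpol q n G"
  shows "(\<lambda>x. G (x, y)) field_differentiable (at x)" "(\<lambda>y. G (x, y)) field_differentiable (at y)"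
  using assms by induction (auto intro!: derivative_intros)

lemma wpol_continuous_on: "wpol q n G \<Longrightarrow> continuous_on S G"
  by (induction rule: wpol.induct) (auto intro!: continuous_intros)

lemma pdu_add:
  assumes "wpol q n G" "wpol q n H"
  shows "pdu (\<lambda>p. G p + H p) = (\<lambda>p. pdu G p + pdu H p)"
  using wpol_field_differentiable(1)[OF assms(1)] wpol_field_differentiable(1)[OF assms(2)]
  by (auto simp: pdu_def fun_eq_iff intro: deriv_add)

lemma pdv_add:
  assumes "wpol q n G" "wpol q n H"
  shows "pdv (\<lambda>p. G p + H p) = (\<lambda>p. pdv G p + pdv H p)"
  using wpol_field_differentiable(2)[OF assms(1)] wpol_field_differentiable(2)[OF assms(2)]
  by (auto simp: pdv_def fun_eq_iff intro: deriv_add)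

lemma pdu_monom:
  "pdu (\<lambda>p. c * fst p ^ i * snd p ^ j) = (\<lambda>p. (c * real i) * fst p ^ (i - 1) * snd p ^ j)"
  by (auto simp: pdu_def fun_eq_iff intro!: DERIV_imp_deriv derivative_eq_intros)

lemma pdv_monom:
  "pdv (\<lambda>p. c * fst p ^ i * snd p ^ j) = (\<lambda>p. (c * real j) * fst p ^ i * snd p ^ (j - 1))"
  by (auto simp: pdv_def fun_eq_iff intro!: DERIV_imp_deriv derivative_eq_intros)

lemma wpol_pdu: "wpol q n G \<Longrightarrow> wpol q n (pdu G)"
  by (induction rule: wpol.induct) (auto simp: pdu_monom pdu_add intro!: wpol.intros)

lemma wpol_pdv: "wpol q n G \<Longrightarrow> wpol q n (pdv G)"
proof (induction rule: wpol.induct)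
  case (monom i j c)
  have "q * (j - 1) \<le> q * j" by simp
  then show ?case using monom unfolding pdv_monom by (intro wpol.monom) linarith
qed (auto simp: pdv_add intro!: wpol.intros)

lemma wpol_has_partials_on: "wpol q n G \<Longrightarrow> has_partials_on S G"
  by (auto simp: has_partials_on_def intro: wpol_continuous_on wpol_field_differentiable)

lemma wpol_C2_on: "wpol q n G \<Longrightarrow> C2_on S G"
  by (auto simp: C2_on_def intro: wpol_has_partials_on wpol_continuous_on wpol_pdu wpol_pdv)

text \<open>Passes from coefficient arrays to a form that admits induction over monomials and
  sums.\<close>

lemma poly2_le_iff_wpol: "poly2_le n P \<longleftrightarrow> wpol 1 n P"
proof
  assume "poly2_le n P"
  then obtain c where c: "\<And>i j. n < i + j \<Longrightarrow> c i j = 0"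
    "\<And>u v. P (u, v) = (\<Sum>i\<le>n. \<Sum>j\<le>n. c i j * u ^ i * v ^ j)"
    by (auto simp: poly2_le_def)
  have "wpol 1 n (\<lambda>p. c i j * fst p ^ i * snd p ^ j)" for i j
    using c(1)[of i j] wpol.monom[of i 1 j n "c i j"] wpol_const[of 1 n 0] by fastforce
  then have "wpol 1 n (\<lambda>p. \<Sum>i\<le>n. \<Sum>j\<le>n. c i j * fst p ^ i * snd p ^ j)"
    by (intro wpol_sum)
  also have "(\<lambda>p. \<Sum>i\<le>n. \<Sum>j\<le>n. c i j * fst p ^ i * snd p ^ j) = P"
    using c(2) by (auto simp: fun_eq_iff)
  finally show "wpol 1 n P" .
next
  assume "wpol 1 n P"
  then show "poly2_le n P"
  proof induction
    case (monom i j c)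
    then have ij: "i \<in> {..n}" "j \<in> {..n}" by auto
    have "(\<Sum>j'\<le>n. (if i' = i \<and> j' = j then c else 0) * u ^ i' * v ^ j')
        = (if i' = i then c * u ^ i * v ^ j else 0)" for i' and u v :: real
      using ij by (subst sum.mono_neutral_right[of _ "{j}"]) auto
    then show ?case using monom ij
      unfolding poly2_le_def by (intro exI[of _ "\<lambda>i' j'. if i' = i \<and> j' = j then c else 0"]) auto
  next
    case (add G H)
    obtain c where c: "\<And>i j. n < i + j \<Longrightarrow> c i j = 0"
      "\<And>u v. G (u, v) = (\<Sum>i\<le>n. \<Sum>j\<le>n. c i j * u ^ i * v ^ j)"
      using add.IH(1) unfolding poly2_le_def by blast
    obtain d where d: "\<And>i j. n < i + j \<Longrightarrow> d i j = 0"
      "\<And>u v. H (u, v) = (\<Sum>i\<le>n. \<Sum>j\<le>n. d i j * u ^ i * v ^ j)"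
      using add.IH(2) unfolding poly2_le_def by blast
    show ?case
      unfolding poly2_le_def
      by (intro exI[of _ "\<lambda>i j. c i j + d i j"]) (simp add: c d sum.distrib algebra_simps)
  qed
qed

text \<open>\<open>tfun = sqrt xi\<close>, so \<open>(u, xi (u, v))\<close> is \<open>psi\<close> with \<open>t\<^sup>2\<close> in place of \<open>t\<close>.\<close>

definition xi :: "real \<Rightarrow> real \<Rightarrow> real \<Rightarrow> real \<times> real \<Rightarrow> real" where
  "xi a b c p = (- a + (a - c) * (fst p)\<^sup>2 + (snd p)\<^sup>2) / (b - a)"

section \<open>Polynomials even in \<open>v\<close> as polynomials in \<open>u\<close> and
  \<open>xi\<close>\<close>

lemma wpol_xi: "wpol 1 2 (xi a b c)"
proof -
  have "wpol 1 2 (\<lambda>p. - a / (b - a) + (((a - c) / (b - a)) * fst p ^ 2 * snd p ^ 0 + (1 / (b - a)) * fst p ^ 0 * snd p ^ 2))"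
    by (intro wpol.add wpol_const wpol.monom) auto
  also have "(\<lambda>p. - a / (b - a) + (((a - c) / (b - a)) * fst p ^ 2 * snd p ^ 0 + (1 / (b - a)) * fst p ^ 0 * snd p ^ 2)) = xi a b c"
    by (auto simp: xi_def fun_eq_iff add_divide_distrib diff_divide_distrib left_diff_distrib)
  finally show ?thesis .
qed

text \<open>\<open>xi\<close> has degree 2 in \<open>(u, v)\<close>, which is exactly the weight of
  the second variable, so the bound \<open>n\<close> is preserved.\<close>

lemma wpol_compose_xi:
  assumes "wpol 2 n G"
  shows "wpol 1 n (\<lambda>p. G (fst p, xi a b c p))"
  using assms
proof induction
  case (monom i j d)
  have "wpol 1 (i + j * 2) (\<lambda>p. (d * fst p ^ i * snd p ^ 0) * xi a b c p ^ j)"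
    by (intro wpol_mult wpol_power wpol_xi wpol.monom) auto
  then show ?case using monom by (auto intro: wpol_mono)
qed (auto intro: wpol.add)

lemma even_wpol_factors_through_xi:
  assumes "wpol 1 n Y" "a < b" and even: "\<And>u v. Y (u, - v) = Y (u, v)"
  obtains G where "wpol 2 n G" "\<And>p. Y p = G (fst p, xi a b c p)"
proof -
  \<comment> \<open>The induction is on the even part, since the summands that build an even
    \<open>Y\<close> need not be even themselves.\<close>
  have "\<exists>G. wpol 2 n G \<and> (\<forall>u v. (Y (u, v) + Y (u, - v)) / 2 = G (u, xi a b c (u, v)))"
    using assms(1)
  proof induction
    case (monom i j d)
    show ?case
    proof (cases "even j")
      case True
      then obtain k where k: "j = 2 * k" by blast
      \<comment> \<open>The base of the power is \<open>v^2\<close> expressed through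
        \<open>u\<close> and \<open>xi\<close>, that is
        \<open>v^2 = a + (c - a) u^2 + (b - a) xi\<close>, of weighted degree 2.\<close>
      have "wpol 2 2 (\<lambda>p. a + (((c - a) * fst p ^ 2 * snd p ^ 0) + (b - a) * fst p ^ 0 * snd p ^ 1))"
        by (intro wpol.add wpol_const wpol.monom) auto
      then have "wpol 2 (i + k * 2) (\<lambda>p. (d * fst p ^ i * snd p ^ 0) *
          (a + (((c - a) * fst p ^ 2 * snd p ^ 0) + (b - a) * fst p ^ 0 * snd p ^ 1)) ^ k)"
        by (intro wpol_mult wpol_power wpol.monom) auto
      then have "wpol 2 n (\<lambda>p. (d * fst p ^ i * snd p ^ 0) *
          (a + (((c - a) * fst p ^ 2 * snd p ^ 0) + (b - a) * fst p ^ 0 * snd p ^ 1)) ^ k)"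
        by (rule wpol_mono) (use monom k in auto)
      moreover have "a + ((c - a) * u\<^sup>2 + (b - a) * xi a b c (u, v)) = v\<^sup>2" for u v
      proof -
        have "(b - a) * xi a b c (u, v) = - a + (a - c) * u\<^sup>2 + v\<^sup>2"
          using \<open>a < b\<close> by (simp add: xi_def)
        then show ?thesis by (simp add: algebra_simps)
      qed
      ultimately show ?thesis
        by (intro exI[of _ "\<lambda>p. (d * fst p ^ i * snd p ^ 0) *
          (a + (((c - a) * fst p ^ 2 * snd p ^ 0) + (b - a) * fst p ^ 0 * snd p ^ 1)) ^ k"])
          (simp add: k power_mult)
    next
      case False
      \<comment> \<open>For odd \<open>j\<close> the two halves of the even part cancel.\<close>
      then show ?thesis by (intro exI[of _ "\<lambda>p. 0"]) (auto intro: wpol_const)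
    qed
  next
    case (add G H)
    then obtain G' H' where GH: "wpol 2 n G'" "wpol 2 n H'"
      "\<And>u v. (G (u, v) + G (u, - v)) / 2 = G' (u, xi a b c (u, v))"
      "\<And>u v. (H (u, v) + H (u, - v)) / 2 = H' (u, xi a b c (u, v))" by metis
    then show ?case
      by (intro exI[of _ "\<lambda>p. G' p + H' p"]) (auto intro: wpol.add GH simp flip: GH(3,4) simp: add_divide_distrib)
  qed
  then show thesis using that by (auto simp: even)
qed

section \<open>The operator under the substitutions \<open>xi\<close> and
  \<open>sqrt xi\<close>\<close>

lemma has_real_derivative_xi:
  assumes "a < b"
  shows "((\<lambda>x. xi a b c (x, y)) has_real_derivative 2 * (a - c) * fst (x, y) / (b - a)) (at x)"
    and "((\<lambda>y. xi a b c (x, y)) has_real_derivative 2 * snd (x, y) / (b - a)) (at y)"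
  using assms unfolding xi_def by (auto intro!: derivative_eq_intros)

text \<open>\<open>Dcal\<close> acting on \<open>f (s, t) = G (s, t\<^sup>2)\<close>.\<close>

definition Dcal_sq :: "real \<Rightarrow> real \<Rightarrow> (real \<times> real \<Rightarrow> real) \<Rightarrow> real \<times> real \<Rightarrow> real" where
  "Dcal_sq k2 k3 G p = (1 - (fst p)\<^sup>2) * pdu (pdu G) p - 4 * fst p * snd p * pdv (pdu G) p
     + 4 * snd p * (1 - snd p) * pdv (pdv G) p - (2 * k2 + 2 * k3 + 3) * fst p * pdu G p
     + (2 + 4 * k2 - 2 * (2 * k2 + 2 * k3 + 4) * snd p) * pdv G p"

text \<open>The chain rule turns \<open>Dfrak\<close> into a combination of the partials of
  \<open>G\<close> at \<open>(u, xi)\<close>; it remains to compare coefficients, which is done in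
  \<open>c_st\<close>, \<open>c_tt\<close> and \<open>c_t\<close>.\<close>

lemma Dfrak_compose_xi:
  assumes G: "wpol 2 n G" and "a < b" "v \<noteq> 0"
  shows "Dfrak a b c k2 k3 (\<lambda>p. G (fst p, xi a b c p)) (u, v) = Dcal_sq k2 k3 G (u, xi a b c (u, v))"
proof -
  have ba: "b - a \<noteq> 0" using \<open>a < b\<close> by simp
  have D1: "\<forall>p\<in>UNIV. ((\<lambda>x. xi a b c (x, snd p)) has_real_derivative 2 * (a - c) * fst p / (b - a)) (at (fst p))"
    and D2: "\<forall>p\<in>UNIV. ((\<lambda>y. xi a b c (fst p, y)) has_real_derivative 2 * snd p / (b - a)) (at (snd p))"
    using has_real_derivative_xi[OF \<open>a < b\<close>] by auto
  have D3: "\<forall>p\<in>UNIV. ((\<lambda>x. 2 * (a - c) * fst (x, snd p) / (b - a)) has_real_derivative 2 * (a - c) / (b - a)) (at (fst p))"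
    using ba by (auto intro!: derivative_eq_intros)
  have D4: "\<forall>p\<in>UNIV. ((\<lambda>y. 2 * (a - c) * fst (fst p, y) / (b - a)) has_real_derivative 0) (at (snd p))"
    by simp
  have D5: "\<forall>p\<in>UNIV. ((\<lambda>y. 2 * snd (fst p, y) / (b - a)) has_real_derivative 2 / (b - a)) (at (snd p))"
    using DERIV_cdivide[OF DERIV_cmult[OF DERIV_ident, of 2], of "b - a"] by simp
  have "\<forall>p\<in>UNIV. (fst p, xi a b c p) \<in> UNIV" by simp
  note P = second_order_chain_rule_graph[OF open_UNIV wpol_C2_on[OF G] open_UNIV this D1 D2 D3 D4 D5 UNIV_I, of u v,
      unfolded fst_conv snd_conv mult_zero_right add_0_right]
  define x where "x = xi a b c (u, v)"
  have x: "x = (- a + (a - c) * u\<^sup>2 + v\<^sup>2) / (b - a)"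
    by (simp add: x_def xi_def)
  \<comment> \<open>The part of the coefficients with \<open>v^2\<close> in the denominator. It
    enters \<open>c_tt\<close> only as the polynomial \<open>E * v^2\<close> and cancels in
    \<open>c_t\<close>.\<close>
  define E where "E = (- a * b + (a - c) * (b - c) * u\<^sup>2) / v\<^sup>2"
  have E: "E * v\<^sup>2 = - a * b + (a - c) * (b - c) * u\<^sup>2"
    using \<open>v \<noteq> 0\<close> by (simp add: E_def)
  have c_st: "(1 - u\<^sup>2) * (2 * (2 * (a - c) * u / (b - a))) - 2 * (v\<^sup>2 - c) * (u / v) * (2 * v / (b - a)) = - 4 * u * x"
    using ba \<open>v \<noteq> 0\<close> by (simp add: x divide_simps) (simp add: algebra_simps power2_eq_square)
  have "((1 - u\<^sup>2) * (2 * (a - c) * u / (b - a))\<^sup>2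
      - 2 * (v\<^sup>2 - c) * (u / v) * ((2 * (a - c) * u / (b - a)) * (2 * v / (b - a)))
      + (a + b - v\<^sup>2 + E) * (2 * v / (b - a))\<^sup>2) =
     4 * ((1 - u\<^sup>2) * (a - c)\<^sup>2 * u\<^sup>2 - 2 * (v\<^sup>2 - c) * u\<^sup>2 * (a - c) + (a + b - v\<^sup>2) * v\<^sup>2 + E * v\<^sup>2) / (b - a)\<^sup>2"
    using ba \<open>v \<noteq> 0\<close> by (simp add: divide_simps) (simp add: algebra_simps power2_eq_square)
  also have "\<dots> = 4 * x * (1 - x)"
    unfolding E using ba by (simp add: x divide_simps) (simp add: algebra_simps power2_eq_square)
  finally have c_tt: "((1 - u\<^sup>2) * (2 * (a - c) * u / (b - a))\<^sup>2
      - 2 * (v\<^sup>2 - c) * (u / v) * ((2 * (a - c) * u / (b - a)) * (2 * v / (b - a)))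
      + (a + b - v\<^sup>2 + E) * (2 * v / (b - a))\<^sup>2) = 4 * x * (1 - x)" .
  have c_t: "(1 - u\<^sup>2) * (2 * (a - c) / (b - a)) + (a + b - v\<^sup>2 + E) * (2 / (b - a))
      + (c - 2 * a - E) * (1 / v) * (2 * v / (b - a))
      - (2 * k2 + 2 * k3 + 3) * (u * (2 * (a - c) * u / (b - a)) + ((v\<^sup>2 - a) / v) * (2 * v / (b - a)))
      + 2 * k2 * (b - a) * (1 / v) * (2 * v / (b - a)) = 2 + 4 * k2 - 2 * (2 * k2 + 2 * k3 + 4) * x"
    using ba \<open>v \<noteq> 0\<close> by (simp add: x divide_simps) (simp add: algebra_simps power2_eq_square)
  have "Dfrak a b c k2 k3 (\<lambda>p. G (fst p, xi a b c p)) (u, v) =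
      (1 - u\<^sup>2) * pdu (pdu G) (u, x)
    + ((1 - u\<^sup>2) * (2 * (2 * (a - c) * u / (b - a))) - 2 * (v\<^sup>2 - c) * (u / v) * (2 * v / (b - a))) * pdv (pdu G) (u, x)
    + ((1 - u\<^sup>2) * (2 * (a - c) * u / (b - a))\<^sup>2
      - 2 * (v\<^sup>2 - c) * (u / v) * ((2 * (a - c) * u / (b - a)) * (2 * v / (b - a)))
      + (a + b - v\<^sup>2 + E) * (2 * v / (b - a))\<^sup>2) * pdv (pdv G) (u, x)
    - (2 * k2 + 2 * k3 + 3) * u * pdu G (u, x)
    + ((1 - u\<^sup>2) * (2 * (a - c) / (b - a)) + (a + b - v\<^sup>2 + E) * (2 / (b - a))
      + (c - 2 * a - E) * (1 / v) * (2 * v / (b - a))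
      - (2 * k2 + 2 * k3 + 3) * (u * (2 * (a - c) * u / (b - a)) + ((v\<^sup>2 - a) / v) * (2 * v / (b - a)))
      + 2 * k2 * (b - a) * (1 / v) * (2 * v / (b - a))) * pdv G (u, x)"
    unfolding Dfrak_def split P x_def[symmetric] E_def[symmetric] by algebra
  then show ?thesis
    unfolding c_st c_tt c_t by (simp add: Dcal_sq_def x_def algebra_simps)
qed

lemma has_real_derivative_sqrt_xi:
  assumes "a < b" "xi a b c (x, y) > 0"
  shows "((\<lambda>x. sqrt (xi a b c (x, y))) has_real_derivative (a - c) * x * inverse ((b - a) * sqrt (xi a b c (x, y)))) (at x)" (is ?A)
   and "((\<lambda>y. sqrt (xi a b c (x, y))) has_real_derivative y * inverse ((b - a) * sqrt (xi a b c (x, y)))) (at y)" (is ?B)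
proof -
  have *: "((\<lambda>x. sqrt (h x)) has_real_derivative (h' * inverse (sqrt (h x)) / 2)) (at x)"
    if "(h has_real_derivative h') (at x)" "h x > 0" for h h' x
    using DERIV_chain2[of sqrt "inverse (sqrt (h x)) / 2" h x h' UNIV] DERIV_real_sqrt that by (simp add: mult_ac)
  show ?A
    by (rule DERIV_cong[OF *[OF has_real_derivative_xi(1)[OF assms(1)] assms(2)]]) (use assms in \<open>simp add: field_simps\<close>)
  show ?B
    by (rule DERIV_cong[OF *[OF has_real_derivative_xi(2)[OF assms(1)] assms(2)]]) (use assms in \<open>simp add: field_simps\<close>)
qed

text \<open>The same comparison of coefficients for \<open>T = sqrt xi\<close>, on an open set where
  \<open>xi\<close> is positive and the root therefore differentiable.\<close>

lemma Dfrak_compose_psi: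
  assumes V: "open V" "C2_on V f" and U: "open U" "\<And>x y. (x, y) \<in> U \<Longrightarrow> (x, sqrt (xi a b c (x, y))) \<in> V"
    and pos: "\<And>x y. (x, y) \<in> U \<Longrightarrow> xi a b c (x, y) > 0"
    and uv: "(u, v) \<in> U" "v \<noteq> 0" and "a < b"
  shows "Dfrak a b c k2 k3 (\<lambda>p. f (fst p, sqrt (xi a b c p))) (u, v) = Dcal k2 k3 f (u, sqrt (xi a b c (u, v)))"
proof -
  define T where "T p = sqrt (xi a b c p)" for p
  define d where "d = b - a"
  define e where "e = a - c"
  have d: "d > 0" using \<open>a < b\<close> by (simp add: d_def)
  have Tpos: "T (x, y) > 0" if "(x, y) \<in> U" for x y using pos[OF that] by (simp add: T_def)
  have D1: "\<forall>p\<in>U. ((\<lambda>x. T (x, snd p)) has_real_derivative e * fst p * inverse (d * T p)) (at (fst p))"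
    and D2: "\<forall>p\<in>U. ((\<lambda>y. T (fst p, y)) has_real_derivative snd p * inverse (d * T p)) (at (snd p))"
    using has_real_derivative_sqrt_xi[OF \<open>a < b\<close> pos] by (auto simp: T_def d_def e_def)
  \<comment> \<open>The derivatives of \<open>T\<close> are kept as polynomials times
    \<open>inverse (d * T p)\<close> and \<open>inverse (d\<^sup>2 * T p ^ 3)\<close>, so that later
    only these two quantities have to be abstracted.\<close>
  have inv: "((\<lambda>x. inverse (d * h x)) has_real_derivative - (h' * inverse (d * h x ^ 2))) (at x)"
    if "(h has_real_derivative h') (at x)" "h x > 0" for h h' x
    using that d by (auto intro!: derivative_eq_intros simp: power2_eq_square)
  have D3: "\<forall>p\<in>U. ((\<lambda>x. e * fst (x, snd p) * inverse (d * T (x, snd p))) has_real_derivative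
      e * inverse (d * T p) - (e * fst p)\<^sup>2 * inverse (d\<^sup>2 * T p ^ 3)) (at (fst p))"
  proof (safe, unfold fst_conv snd_conv)
    fix x y assume xy: "(x, y) \<in> U"
    have "((\<lambda>x. T (x, y)) has_real_derivative e * x * inverse (d * T (x, y))) (at x)"
      using D1 xy by force
    from DERIV_mult[OF DERIV_cmult[OF DERIV_ident, of e] inv[OF this Tpos[OF xy]]]
    show "((\<lambda>x. e * x * inverse (d * T (x, y))) has_real_derivative
      e * inverse (d * T (x, y)) - (e * x)\<^sup>2 * inverse (d\<^sup>2 * T (x, y) ^ 3)) (at x)"
      by (rule DERIV_cong) (simp add: power2_eq_square power3_eq_cube mult_ac)
  qed
  have D45: "((\<lambda>y. inverse (d * T (x, y))) has_real_derivative - (y * inverse (d\<^sup>2 * T (x, y) ^ 3))) (at y)"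
    if xy: "(x, y) \<in> U" for x y
  proof -
    have "((\<lambda>y. T (x, y)) has_real_derivative y * inverse (d * T (x, y))) (at y)"
      using D2 xy by force
    from inv[OF this Tpos[OF xy]] show ?thesis
      by (simp add: power2_eq_square power3_eq_cube mult_ac)
  qed
  have D4: "\<forall>p\<in>U. ((\<lambda>y. e * fst (fst p, y) * inverse (d * T (fst p, y))) has_real_derivative
      - (e * fst p * snd p) * inverse (d\<^sup>2 * T p ^ 3)) (at (snd p))"
  proof (safe, unfold fst_conv snd_conv)
    fix x y assume xy: "(x, y) \<in> U"
    show "((\<lambda>y. e * x * inverse (d * T (x, y))) has_real_derivative
      - (e * x * y) * inverse (d\<^sup>2 * T (x, y) ^ 3)) (at y)"
      by (rule DERIV_cong[OF DERIV_cmult[OF D45[OF xy]]]) simp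
  qed
  have D5: "\<forall>p\<in>U. ((\<lambda>y. snd (fst p, y) * inverse (d * T (fst p, y))) has_real_derivative
      inverse (d * T p) - (snd p)\<^sup>2 * inverse (d\<^sup>2 * T p ^ 3)) (at (snd p))"
  proof (safe, unfold fst_conv snd_conv)
    fix x y assume xy: "(x, y) \<in> U"
    show "((\<lambda>y. y * inverse (d * T (x, y))) has_real_derivative
      inverse (d * T (x, y)) - y\<^sup>2 * inverse (d\<^sup>2 * T (x, y) ^ 3)) (at y)"
      by (rule DERIV_cong[OF DERIV_mult[OF DERIV_ident D45[OF xy]]]) (simp add: power2_eq_square)
  qed
  have "\<forall>p\<in>U. (fst p, T p) \<in> V" using U(2) by (auto simp: T_def)
  note P = second_order_chain_rule_graph[OF V U(1) this D1 D2 D3 D4 D5 uv(1), unfolded fst_conv snd_conv]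
  define t where "t = T (u, v)"
  have t: "t > 0" using Tpos uv by (simp add: t_def)
  have "d * t\<^sup>2 = d * xi a b c (u, v)"
    using pos[OF uv(1)] by (simp add: t_def T_def)
  \<comment> \<open>Besides \<open>t > 0\<close>, this relation is all that the coefficient
    identities use about \<open>t\<close>: it trades \<open>t^2\<close> for a polynomial in
    \<open>u\<close> and \<open>v\<close>.\<close>
  then have N: "d * t\<^sup>2 = - a + e * u\<^sup>2 + v\<^sup>2"
    using d by (simp add: xi_def d_def e_def)
  define E where "E = (- a * b + (a - c) * (b - c) * u\<^sup>2) / v\<^sup>2"
  have E: "E * v\<^sup>2 = - a * b + (a - c) * (b - c) * u\<^sup>2"
    using \<open>v \<noteq> 0\<close> by (simp add: E_def)
  \<comment> \<open>The left side is the second order part of \<open>Dfrak\<close> evaluated on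
    \<open>(e u, v)\<close>, the gradient of \<open>d * t^2 / 2\<close>. It occurs in both
    \<open>c_tt\<close> and \<open>c_t\<close>.\<close>
  have S: "(1 - u\<^sup>2) * e\<^sup>2 * u\<^sup>2 - 2 * (v\<^sup>2 - c) * u\<^sup>2 * e + (a + b - v\<^sup>2) * v\<^sup>2 + E * v\<^sup>2 = (d * t\<^sup>2) * (d - d * t\<^sup>2)"
    unfolding E N unfolding d_def e_def by algebra
  define K where "K = 2 * k2 + 2 * k3 + 3"
  \<comment> \<open>Reciprocals become variables, with \<open>v * w = 1\<close> as the only
    constraint, so that the rearrangements are polynomial identities which \<open>algebra\<close>
    decides. The values of \<open>q\<close> and \<open>m\<close> are inserted afterwards.\<close>
  define w where "w = inverse v"
  define q where "q = inverse (d * t)"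
  define m where "m = inverse (d\<^sup>2 * t ^ 3)"
  have w: "v * w = 1" using \<open>v \<noteq> 0\<close> by (simp add: w_def)
  have "2 * (1 - u\<^sup>2) * (e * u * q) - 2 * (v\<^sup>2 - c) * (u * w) * (v * q) = - 2 * u * (- a + e * u\<^sup>2 + v\<^sup>2) * q"
    unfolding e_def using w by algebra
  also have "\<dots> = - 2 * u * t"
    unfolding N[symmetric] q_def using d t by (simp add: field_simps power2_eq_square)
  finally have c_st: "2 * (1 - u\<^sup>2) * (e * u * q) - 2 * (v\<^sup>2 - c) * (u * w) * (v * q) = - 2 * u * t" .
  have "(1 - u\<^sup>2) * (e * u * q)\<^sup>2 - 2 * (v\<^sup>2 - c) * (u * w) * (e * u * q * (v * q))
      + (a + b - v\<^sup>2 + E) * (v * q)\<^sup>2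
      = ((1 - u\<^sup>2) * e\<^sup>2 * u\<^sup>2 - 2 * (v\<^sup>2 - c) * u\<^sup>2 * e + (a + b - v\<^sup>2) * v\<^sup>2 + E * v\<^sup>2) * q\<^sup>2"
    using w by algebra
  also have "\<dots> = 1 - t\<^sup>2"
    unfolding S q_def using d t by (simp add: field_simps power2_eq_square)
  finally have c_tt: "(1 - u\<^sup>2) * (e * u * q)\<^sup>2 - 2 * (v\<^sup>2 - c) * (u * w) * (e * u * q * (v * q))
      + (a + b - v\<^sup>2 + E) * (v * q)\<^sup>2 = 1 - t\<^sup>2" .
  have "(1 - u\<^sup>2) * (e * q - (e * u)\<^sup>2 * m)
      - 2 * (v\<^sup>2 - c) * (u * w) * (- (e * u * v) * m)
      + (a + b - v\<^sup>2 + E) * (q - v\<^sup>2 * m)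
      + (c - 2 * a - E) * w * (v * q)
      - K * (u * (e * u * q) + ((v\<^sup>2 - a) * w) * (v * q))
      + 2 * k2 * (b - a) * w * (v * q) =
      ((b - e * u\<^sup>2 - v\<^sup>2) - K * (- a + e * u\<^sup>2 + v\<^sup>2) + 2 * k2 * d) * q
      - ((1 - u\<^sup>2) * e\<^sup>2 * u\<^sup>2 - 2 * (v\<^sup>2 - c) * u\<^sup>2 * e + (a + b - v\<^sup>2) * v\<^sup>2 + E * v\<^sup>2) * m"
    unfolding d_def e_def using w by algebra
  also have "b - e * u\<^sup>2 - v\<^sup>2 = d - d * t\<^sup>2"
    unfolding N unfolding d_def by simp
  \<comment> \<open>The terms with \<open>q\<close> give
    \<open>(1 - t^2 - K t^2 + 2 k2) / t\<close>, the term with \<open>m\<close> gives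
    \<open>- (1 - t^2) / t\<close>.\<close>
  also have "(d - d * t\<^sup>2 - K * (- a + e * u\<^sup>2 + v\<^sup>2) + 2 * k2 * d) * q
      - ((1 - u\<^sup>2) * e\<^sup>2 * u\<^sup>2 - 2 * (v\<^sup>2 - c) * u\<^sup>2 * e + (a + b - v\<^sup>2) * v\<^sup>2 + E * v\<^sup>2) * m = 2 * k2 / t - K * t"
    unfolding S N[symmetric] q_def m_def using d t by (simp add: field_simps power2_eq_square power3_eq_cube)
  finally have c_t: "(1 - u\<^sup>2) * (e * q - (e * u)\<^sup>2 * m)
      - 2 * (v\<^sup>2 - c) * (u * w) * (- (e * u * v) * m)
      + (a + b - v\<^sup>2 + E) * (q - v\<^sup>2 * m)
      + (c - 2 * a - E) * w * (v * q)
      - K * (u * (e * u * q) + ((v\<^sup>2 - a) * w) * (v * q))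
      + 2 * k2 * (b - a) * w * (v * q) = 2 * k2 / t - K * t" .
  have "Dfrak a b c k2 k3 (\<lambda>p. f (fst p, T p)) (u, v) =
      (1 - u\<^sup>2) * pdu (pdu f) (u, t)
    + (2 * (1 - u\<^sup>2) * (e * u * q) - 2 * (v\<^sup>2 - c) * (u * w) * (v * q)) * pdv (pdu f) (u, t)
    + ((1 - u\<^sup>2) * (e * u * q)\<^sup>2 - 2 * (v\<^sup>2 - c) * (u * w) * (e * u * q * (v * q))
      + (a + b - v\<^sup>2 + E) * (v * q)\<^sup>2) * pdv (pdv f) (u, t)
    - K * u * pdu f (u, t)
    + ((1 - u\<^sup>2) * (e * q - (e * u)\<^sup>2 * m)
      - 2 * (v\<^sup>2 - c) * (u * w) * (- (e * u * v) * m)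
      + (a + b - v\<^sup>2 + E) * (q - v\<^sup>2 * m)
      + (c - 2 * a - E) * w * (v * q)
      - K * (u * (e * u * q) + ((v\<^sup>2 - a) * w) * (v * q))
      + 2 * k2 * (b - a) * w * (v * q)) * pdv f (u, t)"
    unfolding Dfrak_def split P t_def[symmetric] E_def[symmetric] K_def[symmetric] q_def[symmetric] m_def[symmetric]
    unfolding divide_inverse w_def[symmetric] mult_1
    by algebra
  then show ?thesis
    unfolding c_st c_tt c_t by (simp add: Dcal_def T_def[symmetric] t_def[symmetric] K_def algebra_simps)
qed

section \<open>Interior points of the two domains\<close>

lemma interior_LambdaD:
  assumes "(u, v) \<in> interior (Lambda a b c)" "a < b"
  shows "v > 0" "xi a b c (u, v) > 0" "u\<^sup>2 + xi a b c (u, v) < 1"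
proof -
  obtain r where r: "r > 0" "ball (u, v) r \<subseteq> Lambda a b c"
    using assms(1) by (auto simp: mem_interior)
  \<comment> \<open>Moving \<open>v\<close> by \<open>r / 2\<close> down and up stays in
    \<open>Lambda\<close>; the non-strict bounds there become strict at \<open>v\<close>, because
    squaring is strictly monotone on nonnegative numbers.\<close>
  then have "(u, v - r / 2) \<in> ball (u, v) r" "(u, v + r / 2) \<in> ball (u, v) r"
    by (auto simp: dist_Pair_Pair dist_real_def)
  with r have L: "(u, v - r / 2) \<in> Lambda a b c" "(u, v + r / 2) \<in> Lambda a b c" by auto
  then show "v > 0" using r by (auto simp: Lambda_def)
  have "(v - r / 2)\<^sup>2 < v\<^sup>2" "v\<^sup>2 < (v + r / 2)\<^sup>2"
    using L(1) r by (auto simp: Lambda_def intro!: power_strict_mono)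
  then have "a + (c - a) * u\<^sup>2 < v\<^sup>2" "v\<^sup>2 < b + (c - b) * u\<^sup>2"
    using L by (auto simp: Lambda_def Omega_def)
  then show "xi a b c (u, v) > 0" "u\<^sup>2 + xi a b c (u, v) < 1"
    using \<open>a < b\<close> by (auto simp: xi_def field_simps)
qed

lemma open_disk_subset_interior_upper_half_disk:
  assumes "s\<^sup>2 + t\<^sup>2 < 1" "t > 0"
  shows "(s, t) \<in> interior upper_half_disk"
proof -
  let ?S = "{p :: real \<times> real. (fst p)\<^sup>2 + (snd p)\<^sup>2 < 1 \<and> 0 < snd p}"
  have "open ?S"
    by (intro open_Collect_conj open_Collect_less continuous_intros)
  moreover have "?S \<subseteq> upper_half_disk"
    by (auto simp: upper_half_disk_def)
  ultimately have "?S \<subseteq> interior upper_half_disk" by (rule interior_maximal[rotated])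
  then show ?thesis using assms by auto
qed

lemma Dfrak_psi_eq_Dcal:
  assumes "a < b" "C2_on (interior upper_half_disk) f" "p \<in> interior (Lambda a b c)"
  shows "Dfrak a b c k2 k3 (f \<circ> psi a b c) p = Dcal k2 k3 f (psi a b c p)"
proof -
  obtain u v where p: "p = (u, v)" by (cases p)
  have psi: "psi a b c q = (fst q, sqrt (xi a b c q))" for q
    by (auto simp: psi_def tfun_def xi_def split_beta)
  have "Dfrak a b c k2 k3 (\<lambda>p. f (fst p, sqrt (xi a b c p))) (u, v) = Dcal k2 k3 f (u, sqrt (xi a b c (u, v)))"
  proof (rule Dfrak_compose_psi[OF _ assms(2) open_interior])
    show "(x, sqrt (xi a b c (x, y))) \<in> interior upper_half_disk" if "(x, y) \<in> interior (Lambda a b c)" for x y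
      using interior_LambdaD[OF that \<open>a < b\<close>] by (intro open_disk_subset_interior_upper_half_disk) auto
    show "xi a b c (x, y) > 0" if "(x, y) \<in> interior (Lambda a b c)" for x y
      using interior_LambdaD[OF that \<open>a < b\<close>] by simp
    show "(u, v) \<in> interior (Lambda a b c)" "v \<noteq> 0"
      using assms(3) interior_LambdaD(1)[of u v a b c] \<open>a < b\<close> by (auto simp: p)
  qed (use \<open>a < b\<close> in auto)
  then show ?thesis by (simp add: p comp_def psi)
qed

section \<open>Action of the operator on monomials\<close>

lemma Dcal_sq_monom:
  "Dcal_sq k2 k3 (\<lambda>p. c * fst p ^ i * snd p ^ j) = (\<lambda>p.
     c * (real i * (real i - 1)) * fst p ^ (i - 2) * snd p ^ j
   + (c * (2 * real j * (2 * real j - 1 + 2 * k2)) * fst p ^ i * snd p ^ (j - 1)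
   + (- c * (real (i + 2 * j) * (real (i + 2 * j) + 2 * k2 + 2 * k3 + 2))) * fst p ^ i * snd p ^ j))"
proof
  fix p :: "real \<times> real"
  obtain s x where p: "p = (s, x)" by (cases p)
  \<comment> \<open>The exponents are truncated differences; for \<open>i = 0\<close> and
    \<open>i = 1\<close> the factor \<open>real i * (real i - 1)\<close> is zero. The next three
    facts rely on vanishing factors in the same way.\<close>
  have i: "(1 - s\<^sup>2) * (real i * real (i - 1) * s ^ (i - 1 - 1)) =
      real i * (real i - 1) * s ^ (i - 2) - real i * (real i - 1) * s ^ i"
    by (cases i; cases "i - 1") (auto simp: algebra_simps power2_eq_square)
  have i1: "real i * s ^ (i - 1) * s = real i * s ^ i" by (cases i) auto
  have j: "x * (real j * real (j - 1) * x ^ (j - 1 - 1)) = real j * (real j - 1) * x ^ (j - 1)"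
    by (cases j; cases "j - 1") (auto simp: algebra_simps)
  have j1: "real j * x ^ (j - 1) * x = real j * x ^ j" by (cases j) auto
  have "Dcal_sq k2 k3 (\<lambda>p. c * fst p ^ i * snd p ^ j) p =
      c * x ^ j * ((1 - s\<^sup>2) * (real i * real (i - 1) * s ^ (i - 1 - 1)))
    - 4 * c * (real i * s ^ (i - 1) * s) * (real j * x ^ (j - 1) * x)
    + 4 * c * s ^ i * (1 - x) * (x * (real j * real (j - 1) * x ^ (j - 1 - 1)))
    - (2 * k2 + 2 * k3 + 3) * c * x ^ j * (real i * s ^ (i - 1) * s)
    + c * s ^ i * ((2 + 4 * k2) * (real j * x ^ (j - 1)) - 2 * (2 * k2 + 2 * k3 + 4) * (real j * x ^ (j - 1) * x))"
    unfolding Dcal_sq_def pdu_monom pdv_monom by (simp add: p algebra_simps)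
  also have "4 * c * s ^ i * (1 - x) * (x * (real j * real (j - 1) * x ^ (j - 1 - 1))) =
      4 * c * s ^ i * ((real j - 1) * (real j * x ^ (j - 1)) - (real j - 1) * (real j * x ^ (j - 1) * x))"
    unfolding j by (simp add: algebra_simps)
  finally show "Dcal_sq k2 k3 (\<lambda>p. c * fst p ^ i * snd p ^ j) p =
     c * (real i * (real i - 1)) * fst p ^ (i - 2) * snd p ^ j
   + (c * (2 * real j * (2 * real j - 1 + 2 * k2)) * fst p ^ i * snd p ^ (j - 1)
   + (- c * (real (i + 2 * j) * (real (i + 2 * j) + 2 * k2 + 2 * k3 + 2))) * fst p ^ i * snd p ^ j)"
    unfolding i i1 j1 by (simp add: p algebra_simps)
qed

lemma Dcal_sq_add:
  assumes "wpol q n G" "wpol q n H"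
  shows "Dcal_sq k2 k3 (\<lambda>p. G p + H p) = (\<lambda>p. Dcal_sq k2 k3 G p + Dcal_sq k2 k3 H p)"
  unfolding Dcal_sq_def pdu_add[OF assms] pdv_add[OF assms] pdu_add[OF assms[THEN wpol_pdu]]
    pdv_add[OF assms[THEN wpol_pdu]] pdv_add[OF assms[THEN wpol_pdv]]
  by (simp add: algebra_simps)

text \<open>The degree bound is asked only for a nonzero coefficient: where an exponent is
  truncated, or a leading term cancels, the coefficient is zero.\<close>

lemma wpol_monom_coeff:
  assumes "c \<noteq> 0 \<Longrightarrow> i + q * j \<le> n"
  shows "wpol q n (\<lambda>p. c * fst p ^ i * snd p ^ j)"
proof (cases "c = 0")
  case True
  then show ?thesis using wpol_const[of q n 0] by simp
qed (use assms in \<open>auto intro: wpol.monom\<close>)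

text \<open>The eigenvalue is chosen so that the leading terms cancel.\<close>

lemma wpol_Dcal_sq_eigen:
  assumes "wpol 2 n G"
  shows "wpol 2 (n - 1) (\<lambda>p. Dcal_sq k2 k3 G p + real n * (real n + 2 * k2 + 2 * k3 + 2) * G p)"
  using assms
proof induction
  case (monom i j c)
  let ?l = "\<lambda>n. real n * (real n + 2 * k2 + 2 * k3 + 2)"
  have "wpol 2 (n - 1) (\<lambda>p. c * (real i * (real i - 1)) * fst p ^ (i - 2) * snd p ^ j
     + (c * (2 * real j * (2 * real j - 1 + 2 * k2)) * fst p ^ i * snd p ^ (j - 1)
     + (c * (?l n - ?l (i + 2 * j))) * fst p ^ i * snd p ^ j))"
  proof (intro wpol.add wpol_monom_coeff)
    show "i - 2 + 2 * j \<le> n - 1" if "c * (real i * (real i - 1)) \<noteq> 0"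
      using that monom by (cases i; cases "i - 1") auto
    show "i + 2 * (j - 1) \<le> n - 1" if "c * (2 * real j * (2 * real j - 1 + 2 * k2)) \<noteq> 0"
      using that monom by (cases j) auto
    have "i + 2 * j \<noteq> n" if "c * (?l n - ?l (i + 2 * j)) \<noteq> 0"
      using that by fastforce
    then show "i + 2 * j \<le> n - 1" if "c * (?l n - ?l (i + 2 * j)) \<noteq> 0"
      using that monom by fastforce
  qed
  then show ?case unfolding Dcal_sq_monom by (simp add: algebra_simps)
next
  case (add G H)
  from wpol.add[OF add.IH] show ?case
    unfolding Dcal_sq_add[OF add.hyps] by (simp add: algebra_simps)
qed

lemma wpol_Dcal_sq: "wpol 2 n G \<Longrightarrow> wpol 2 n (Dcal_sq k2 k3 G)"
proof -
  assume G: "wpol 2 n G"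
  let ?l = "real n * (real n + 2 * k2 + 2 * k3 + 2)"
  have "wpol 2 n (\<lambda>p. (Dcal_sq k2 k3 G p + ?l * G p) + (- ?l) * G p)"
    by (intro wpol.add wpol_cmult G wpol_mono[OF wpol_Dcal_sq_eigen[OF G]]) simp
  then show ?thesis by simp
qed

section \<open>Moments of the weight\<close>

lemma nn_integral_even:
  fixes f :: "real \<Rightarrow> ennreal"
  assumes [measurable]: "f \<in> borel_measurable borel" and even: "\<And>x. f (- x) = f x"
  shows "(\<integral>\<^sup>+x. f x \<partial>lborel) = 2 * (\<integral>\<^sup>+x. f x * indicator {0..} x \<partial>lborel)"
proof -
  have "(\<integral>\<^sup>+x. f x \<partial>lborel) = (\<integral>\<^sup>+x. f x * indicator {0..} x + f x * indicator {..0} x \<partial>lborel)"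
    by (intro nn_integral_cong_AE AE_I[of _ _ "{0}"]) (auto simp: indicator_def)
  also have "\<dots> = (\<integral>\<^sup>+x. f x * indicator {0..} x \<partial>lborel) + (\<integral>\<^sup>+x. f x * indicator {..0} x \<partial>lborel)"
    by (rule nn_integral_add) auto
  also have "(\<integral>\<^sup>+x. f x * indicator {..0} x \<partial>lborel) = (\<integral>\<^sup>+x. f x * indicator {0..} x \<partial>lborel)"
    by (subst nn_integral_real_affine[of _ "-1" 0]) (auto simp: even indicator_def intro!: nn_integral_cong)
  finally show ?thesis by (simp add: mult_2)
qed

lemma nn_integral_Beta_real:
  assumes "a > 0" "b > 0"
  shows "(\<integral>\<^sup>+t. ennreal (t powr (a - 1) * (1 - t) powr (b - 1)) * indicator {0..1} t \<partial>lborel) = ennreal (Beta a b)"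
  using nn_integral_has_integral_lebesgue'[OF _ has_integral_Beta_real[OF assms]] by simp

text \<open>Substituting \<open>t = s^2\<close> in the Beta integral gives twice the integral over
  the positive half, which by evenness is the whole integral.\<close>

lemma nn_integral_abs_power_Beta:
  fixes b :: real
  assumes "b > -1"
  shows "(\<integral>\<^sup>+s. ennreal (\<bar>s\<bar> ^ i * (1 - s\<^sup>2) powr b) * indicator {-1..1} s \<partial>lborel)
      = ennreal (Beta ((real i + 1) / 2) (b + 1))"
proof -
  \<comment> \<open>Chosen so that \<open>(s\<^sup>2) powr e * s = s ^ i\<close> for
    \<open>s > 0\<close>.\<close>
  define e where "e = (real i + 1) / 2 - 1"
  have "ennreal (Beta ((real i + 1) / 2) (b + 1)) =
      (\<integral>\<^sup>+t. ennreal (t powr e * (1 - t) powr b * indicator {0\<^sup>2..1\<^sup>2} t) \<partial>lborel)"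
    using nn_integral_Beta_real[of "(real i + 1) / 2" "b + 1"] assms
    by (simp add: e_def ennreal_mult' ennreal_indicator)
  also have "\<dots> = (\<integral>\<^sup>+s. ennreal ((s\<^sup>2) powr e * (1 - s\<^sup>2) powr b * (2 * s) * indicator {0..1} s) \<partial>lborel)"
    by (subst nn_integral_substitution[where g = "\<lambda>x. x\<^sup>2" and g' = "\<lambda>x. 2 * x"])
      (auto intro!: derivative_eq_intros continuous_intros simp: set_borel_measurable_def)
  also have "\<dots> = (\<integral>\<^sup>+s. 2 * (ennreal (\<bar>s\<bar> ^ i * (1 - s\<^sup>2) powr b) * indicator {-1..1} s * indicator {0..} s) \<partial>lborel)"
  \<comment> \<open>The point 0 is excluded: for \<open>i = 0\<close> the right side is positive
    there, while the factor \<open>2 * s\<close> makes the left side zero.\<close>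
  proof (intro nn_integral_cong_AE AE_I[of _ _ "{0}"])
    have "ennreal ((s\<^sup>2) powr e * (1 - s\<^sup>2) powr b * (2 * s)) = 2 * ennreal (\<bar>s\<bar> ^ i * (1 - s\<^sup>2) powr b)" if "s > 0" for s :: real
    proof -
      have "s\<^sup>2 = s powr 2" "s = s powr 1" using that by simp_all
      then have "(s\<^sup>2) powr e * s = s powr (2 * e + 1)"
        by (metis powr_powr powr_add)
      also have "2 * e + 1 = real i" by (simp add: e_def field_simps)
      finally have "(s\<^sup>2) powr e * s = \<bar>s\<bar> ^ i" using that by (simp add: powr_realpow)
      then have "(s\<^sup>2) powr e * (1 - s\<^sup>2) powr b * (2 * s) = 2 * (\<bar>s\<bar> ^ i * (1 - s\<^sup>2) powr b)"
        by (metis mult.assoc mult.commute)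
      then show ?thesis using ennreal_mult'[of 2 "\<bar>s\<bar> ^ i * (1 - s\<^sup>2) powr b"] by (simp only: ennreal_numeral)
    qed
    then show "{s \<in> space lborel. ennreal ((s\<^sup>2) powr e * (1 - s\<^sup>2) powr b * (2 * s) * indicator {0..1} s) \<noteq>
        2 * (ennreal (\<bar>s\<bar> ^ i * (1 - s\<^sup>2) powr b) * indicator {-1..1} s * indicator {0..} s)} \<subseteq> {0}"
      by (auto simp: indicator_def less_le split: if_splits)
  qed auto
  also have "\<dots> = 2 * (\<integral>\<^sup>+s. ennreal (\<bar>s\<bar> ^ i * (1 - s\<^sup>2) powr b) * indicator {-1..1} s * indicator {0..} s \<partial>lborel)"
    by (rule nn_integral_cmult) auto
  also have "\<dots> = (\<integral>\<^sup>+s. ennreal (\<bar>s\<bar> ^ i * (1 - s\<^sup>2) powr b) * indicator {-1..1} s \<partial>lborel)"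
    by (rule nn_integral_even[symmetric]) (auto simp: indicator_def)
  finally show ?thesis ..
qed

text \<open>For fixed \<open>u\<close> the substitution \<open>y = (v\<^sup>2 - A) / (B - A)\<close> maps both branches
  \<open>A \<le> v\<^sup>2 \<le> B\<close> to the unit interval.\<close>

lemma nn_integral_square_branches:
  fixes A B :: real and f :: "real \<Rightarrow> real"
  assumes "0 \<le> A" "A < B" and [measurable]: "f \<in> borel_measurable borel"
  shows "(\<integral>\<^sup>+v. ennreal (f ((v\<^sup>2 - A) / (B - A)) * \<bar>v\<bar> / (B - A)) * indicator {v. A \<le> v\<^sup>2 \<and> v\<^sup>2 \<le> B} v \<partial>lborel)
      = (\<integral>\<^sup>+y. ennreal (f y) * indicator {0..1} y \<partial>lborel)"
proof -
  have [measurable]: "{v::real. A \<le> v\<^sup>2 \<and> v\<^sup>2 \<le> B} \<in> sets borel" by measurable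
  define g where "g v = (v\<^sup>2 - A) / (B - A)" for v
  have g: "g (sqrt A) = 0" "g (sqrt B) = 1" using assms by (auto simp: g_def)
  have "(\<integral>\<^sup>+y. ennreal (f y) * indicator {0..1} y \<partial>lborel) =
      (\<integral>\<^sup>+y. ennreal (f y * indicator {g (sqrt A)..g (sqrt B)} y) \<partial>lborel)"
    by (intro nn_integral_cong) (auto simp: g indicator_def)
  also have "\<dots> = (\<integral>\<^sup>+v. ennreal (f (g v) * (2 * v / (B - A)) * indicator {sqrt A..sqrt B} v) \<partial>lborel)"
  proof (rule nn_integral_substitution)
    show "set_borel_measurable borel {g (sqrt A)..g (sqrt B)} f"
      by (simp add: set_borel_measurable_def)
    show "(g has_real_derivative 2 * v / (B - A)) (at v)" for v
      unfolding g_def using assms by (auto intro!: derivative_eq_intros)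
    show "continuous_on {sqrt A..sqrt B} (\<lambda>v. 2 * v / (B - A))"
      using assms by (intro continuous_intros) auto
    have "sqrt A \<ge> 0" using assms by simp
    then have "0 \<le> v" if "v \<in> {sqrt A..sqrt B}" for v
      using that by (meson atLeastAtMost_iff order_trans)
    then show "0 \<le> 2 * v / (B - A)" if "v \<in> {sqrt A..sqrt B}" for v
      using that assms by simp
    show "sqrt A \<le> sqrt B" using assms by simp
  qed
  \<comment> \<open>The derivative \<open>2 * v / (B - A)\<close> is read as twice the density on
    the upper branch; evenness turns the factor 2 into the lower branch.\<close>
  also have "\<dots> = (\<integral>\<^sup>+v. 2 * (ennreal (f (g v) * \<bar>v\<bar> / (B - A)) * indicator {v. A \<le> v\<^sup>2 \<and> v\<^sup>2 \<le> B} v * indicator {0..} v) \<partial>lborel)"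
  proof (intro nn_integral_cong)
    fix v :: real
    show "ennreal (f (g v) * (2 * v / (B - A)) * indicator {sqrt A..sqrt B} v) =
        2 * (ennreal (f (g v) * \<bar>v\<bar> / (B - A)) * indicator {v. A \<le> v\<^sup>2 \<and> v\<^sup>2 \<le> B} v * indicator {0..} v)"
    proof (cases "v \<ge> 0")
      case True
      then have "sqrt A \<le> v \<longleftrightarrow> A \<le> v\<^sup>2" "v \<le> sqrt B \<longleftrightarrow> v\<^sup>2 \<le> B"
        using real_sqrt_le_iff'[of A v] real_sqrt_le_iff[of "v\<^sup>2" B] assms(1) unfolding real_sqrt_abs by simp_all
      moreover have "ennreal (f (g v) * (2 * v / (B - A))) = 2 * ennreal (f (g v) * v / (B - A))"
        using ennreal_mult'[of 2 "f (g v) * v / (B - A)"] by (simp add: mult_ac)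
      ultimately show ?thesis using True by (simp add: indicator_def)
    next
      case False
      moreover have "\<not> sqrt A \<le> v" using False assms(1) by (meson order_trans real_sqrt_ge_zero)
      ultimately show ?thesis by simp
    qed
  qed
  also have "\<dots> = 2 * (\<integral>\<^sup>+v. ennreal (f (g v) * \<bar>v\<bar> / (B - A)) * indicator {v. A \<le> v\<^sup>2 \<and> v\<^sup>2 \<le> B} v * indicator {0..} v \<partial>lborel)"
    unfolding g_def by (rule nn_integral_cmult) measurable
  also have "\<dots> = (\<integral>\<^sup>+v. ennreal (f (g v) * \<bar>v\<bar> / (B - A)) * indicator {v. A \<le> v\<^sup>2 \<and> v\<^sup>2 \<le> B} v \<partial>lborel)"
    unfolding g_def by (rule nn_integral_even[symmetric]) (measurable, auto simp: indicator_def)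
  finally show ?thesis by (simp add: g_def)
qed

section \<open>The weight and the domain in the coordinate \<open>xi\<close>\<close>

lemma Wt_eq:
  assumes "a < b"
  shows "Wt a b c k2 k3 p = \<bar>snd p\<bar> * xi a b c p powr (k2 - 1/2) * (1 - (fst p)\<^sup>2 - xi a b c p) powr k3"
proof -
  have "(b - (b - c) * u\<^sup>2 - v\<^sup>2) / (b - a) = 1 - u\<^sup>2 - (- a + (a - c) * u\<^sup>2 + v\<^sup>2) / (b - a)" for u v
    using assms by (simp add: field_simps)
  then show ?thesis by (simp add: Wt_def xi_def split_beta)
qed

lemma Omega_iff:
  assumes "a < b"
  shows "p \<in> Omega a b c \<longleftrightarrow> \<bar>fst p\<bar> \<le> 1 \<and> 0 \<le> xi a b c p \<and> (fst p)\<^sup>2 + xi a b c p \<le> 1"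
proof -
  have "b - a > 0" using assms by simp
  then have "0 \<le> xi a b c p \<longleftrightarrow> a + (c - a) * (fst p)\<^sup>2 \<le> (snd p)\<^sup>2"
    "(fst p)\<^sup>2 + xi a b c p \<le> 1 \<longleftrightarrow> (snd p)\<^sup>2 \<le> b + (c - b) * (fst p)\<^sup>2"
    by (auto simp: xi_def field_simps)
  then show ?thesis by (auto simp: Omega_def split_beta)
qed

lemma xi_measurable [measurable]: "xi a b c \<in> borel_measurable borel"
  unfolding xi_def divide_inverse by (intro borel_measurable_continuous_onI continuous_intros)

lemma Omega_measurable [measurable]: "a < b \<Longrightarrow> Omega a b c \<in> sets borel"
proof -
  assume "a < b"
  have [measurable]: "fst \<in> borel_measurable (borel :: (real \<times> real) measure)"
    by (intro borel_measurable_continuous_onI continuous_intros)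
  have "Omega a b c = {p \<in> space borel. \<bar>fst p\<bar> \<le> 1 \<and> 0 \<le> xi a b c p \<and> (fst p)\<^sup>2 + xi a b c p \<le> 1}"
    using Omega_iff[OF \<open>a < b\<close>] by auto
  also have "\<dots> \<in> sets borel" by measurable
  finally show ?thesis .
qed

lemma Wt_measurable [measurable]: "a < b \<Longrightarrow> Wt a b c k2 k3 \<in> borel_measurable borel"
proof -
  assume "a < b"
  have [measurable]: "fst \<in> borel_measurable (borel :: (real \<times> real) measure)"
    "snd \<in> borel_measurable (borel :: (real \<times> real) measure)"
    by (intro borel_measurable_continuous_onI continuous_intros)+
  have "Wt a b c k2 k3 = (\<lambda>p. \<bar>snd p\<bar> * xi a b c p powr (k2 - 1/2) * (1 - (fst p)\<^sup>2 - xi a b c p) powr k3)"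
    using Wt_eq[OF \<open>a < b\<close>] by auto
  also have "\<dots> \<in> borel_measurable borel" by measurable
  finally show ?thesis .
qed

text \<open>With \<open>r = 1 - u^2\<close> and \<open>xi = r * y\<close>, the bases of the two
  powers in the weight are \<open>r * y\<close> and \<open>r * (1 - y)\<close>. The powers of
  \<open>r\<close> split off, \<open>|v|\<close> is the Jacobian of \<open>v \<mapsto> y\<close> up
  to a constant, and a Beta integral in \<open>y\<close> remains.\<close>

lemma nn_integral_Wt_slice:
  assumes "0 \<le> a" "a < b" "0 \<le> c" "k2 > - 1/2" "k3 > - 1" and u: "\<bar>u\<bar> < 1"
  shows "(\<integral>\<^sup>+v. ennreal (indicator (Omega a b c) (u, v) * (Wt a b c k2 k3 (u, v) * xi a b c (u, v) ^ j)) \<partial>lborel)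
      = ennreal ((b - a) * (1 - u\<^sup>2) powr (real j + k2 + k3 + 1/2) * Beta (real j + k2 + 1/2) (k3 + 1))"
proof -
  define A where "A = a + (c - a) * u\<^sup>2"
  define B where "B = b + (c - b) * u\<^sup>2"
  define r where "r = 1 - u\<^sup>2"
  have r: "r > 0" using u by (simp add: r_def abs_square_less_1)
  have BA: "B - A = (b - a) * r" by (simp add: A_def B_def r_def algebra_simps)
  moreover have "0 < (b - a) * r" using r assms by simp
  ultimately have AB: "A < B" by linarith
  \<comment> \<open>A convex combination of \<open>a\<close> and \<open>c\<close>; this is where
    \<open>0 \<le> a\<close> and \<open>0 \<le> c\<close> enter.\<close>
  have "A = a * r + c * u\<^sup>2" by (simp add: A_def r_def algebra_simps)
  then have A: "0 \<le> A" using r assms by simp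
  define f where "f y = y powr (real j + k2 + 1/2 - 1) * (1 - y) powr (k3 + 1 - 1)" for y :: real
  \<comment> \<open>The exponent collects \<open>k2 - 1/2 + j\<close> and \<open>k3\<close> from the
    integrand and 1 from \<open>B - A = (b - a) * r\<close>.\<close>
  define C where "C = (b - a) * r powr (real j + k2 + k3 + 1/2)"
  have C: "C \<ge> 0" using assms by (simp add: C_def)
  have "(\<integral>\<^sup>+v. ennreal (indicator (Omega a b c) (u, v) * (Wt a b c k2 k3 (u, v) * xi a b c (u, v) ^ j)) \<partial>lborel)
     = (\<integral>\<^sup>+v. ennreal C * (ennreal (f ((v\<^sup>2 - A) / (B - A)) * \<bar>v\<bar> / (B - A)) * indicator {v. A \<le> v\<^sup>2 \<and> v\<^sup>2 \<le> B} v) \<partial>lborel)"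
  proof (intro nn_integral_cong)
    fix v :: real
    define y where "y = (v\<^sup>2 - A) / (B - A)"
    have xi: "xi a b c (u, v) = r * y"
    proof -
      have "r * y = (v\<^sup>2 - A) / (b - a)" using r by (simp add: y_def BA)
      then show ?thesis by (simp add: xi_def A_def algebra_simps)
    qed
    have Om: "(u, v) \<in> Omega a b c \<longleftrightarrow> A \<le> v\<^sup>2 \<and> v\<^sup>2 \<le> B"
      using u by (simp add: Omega_def A_def B_def)
    show "ennreal (indicator (Omega a b c) (u, v) * (Wt a b c k2 k3 (u, v) * xi a b c (u, v) ^ j)) =
        ennreal C * (ennreal (f ((v\<^sup>2 - A) / (B - A)) * \<bar>v\<bar> / (B - A)) * indicator {v. A \<le> v\<^sup>2 \<and> v\<^sup>2 \<le> B} v)"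
    proof (cases "(u, v) \<in> Omega a b c")
      case True
      then have y: "0 \<le> y" "y \<le> 1" using AB Om by (auto simp: y_def)
      have r1: "1 - u\<^sup>2 - r * y = r * (1 - y)" by (simp add: r_def algebra_simps)
      \<comment> \<open>Valid also at \<open>x = 0\<close>, where \<open>powr\<close> is 0 for every
        exponent.\<close>
      have pow: "x powr e * x ^ j = x powr (e + real j)" if "x \<ge> 0" for x e :: real
        using that by (cases "x = 0") (auto simp: powr_add powr_realpow)
      have "Wt a b c k2 k3 (u, v) * xi a b c (u, v) ^ j =
          \<bar>v\<bar> * ((r * y) powr (k2 - 1/2) * (r * y) ^ j) * (r * (1 - y)) powr k3"
        by (simp add: Wt_eq[OF \<open>a < b\<close>] xi r1 mult_ac)
      also have "(r * y) powr (k2 - 1/2) * (r * y) ^ j = (r * y) powr (k2 - 1/2 + real j)"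
        using r y by (intro pow) simp
      also have "\<bar>v\<bar> * \<dots> * (r * (1 - y)) powr k3 =
          \<bar>v\<bar> * (r powr (k2 - 1/2 + real j) * r powr k3) * (y powr (k2 - 1/2 + real j) * (1 - y) powr k3)"
        using r y by (simp add: powr_mult mult_ac)
      also have "r powr (k2 - 1/2 + real j) * r powr k3 = r powr (real j + k2 + k3 + 1/2) / r"
      proof -
        have "r powr (k2 - 1/2 + real j) * r powr k3 = r powr ((real j + k2 + k3 + 1/2) - 1)"
          unfolding powr_add[symmetric] by (rule arg_cong[where f = "(powr) r"]) simp
        then show ?thesis using r by (simp only: powr_diff powr_one)
      qed
      also have "y powr (k2 - 1/2 + real j) * (1 - y) powr k3 = f y"
        by (simp add: f_def algebra_simps)
      also have "\<bar>v\<bar> * (r powr (real j + k2 + k3 + 1/2) / r) * f y = C * (f y * \<bar>v\<bar> / (B - A))"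
        using r assms by (simp add: C_def BA)
      finally have "ennreal (Wt a b c k2 k3 (u, v) * xi a b c (u, v) ^ j) = ennreal C * ennreal (f y * \<bar>v\<bar> / (B - A))"
        by (simp only: ennreal_mult'[OF C])
      then show ?thesis using True Om by (simp add: y_def)
    next
      case False
      then show ?thesis using Om by (auto simp: indicator_def)
    qed
  qed
  also have "\<dots> = ennreal C * (\<integral>\<^sup>+v. ennreal (f ((v\<^sup>2 - A) / (B - A)) * \<bar>v\<bar> / (B - A)) * indicator {v. A \<le> v\<^sup>2 \<and> v\<^sup>2 \<le> B} v \<partial>lborel)"
    unfolding f_def by (rule nn_integral_cmult) measurable
  also have "\<dots> = ennreal C * (\<integral>\<^sup>+y. ennreal (f y) * indicator {0..1} y \<partial>lborel)"
  proof -
    have "f \<in> borel_measurable borel" unfolding f_def by measurable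
    then show ?thesis using nn_integral_square_branches[OF A AB] by simp
  qed
  also have "\<dots> = ennreal C * ennreal (Beta (real j + k2 + 1/2) (k3 + 1))"
    unfolding f_def using assms by (subst nn_integral_Beta_real) auto
  also have "\<dots> = ennreal (C * Beta (real j + k2 + 1/2) (k3 + 1))"
    using C by (simp add: ennreal_mult')
  finally show ?thesis by (simp add: C_def r_def)
qed

text \<open>Tonelli over the slices; the outer integral is again of Beta type. The absolute value
  makes the result usable as an integrability bound for odd \<open>i\<close> too.\<close>

lemma nn_integral_Wt_moment:
  assumes "0 \<le> a" "a < b" "0 \<le> c" "k2 > - 1/2" "k3 > - 1"
  shows "(\<integral>\<^sup>+p. ennreal (indicator (Omega a b c) p * (Wt a b c k2 k3 p * (\<bar>fst p\<bar> ^ i * xi a b c p ^ j))) \<partial>lborel)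
      = ennreal ((b - a) * Beta (real j + k2 + 1/2) (k3 + 1) * Beta ((real i + 1) / 2) (real j + k2 + k3 + 3/2))"
proof -
  define C where "C = (b - a) * Beta (real j + k2 + 1/2) (k3 + 1)"
  have "Beta (real j + k2 + 1/2) (k3 + 1) \<ge> 0"
    using assms by (simp add: Beta_def Gamma_real_nonneg)
  then have C: "C \<ge> 0" using assms by (simp add: C_def)
  let ?h = "\<lambda>p. ennreal (indicator (Omega a b c) p * (Wt a b c k2 k3 p * (\<bar>fst p\<bar> ^ i * xi a b c p ^ j)))"
  have [measurable]: "fst \<in> borel_measurable (borel :: (real \<times> real) measure)"
    by (intro borel_measurable_continuous_onI continuous_intros)
  have [measurable]: "?h \<in> borel_measurable borel"
    using \<open>a < b\<close> by measurable
  have "(\<integral>\<^sup>+p. ?h p \<partial>lborel) = (\<integral>\<^sup>+u. \<integral>\<^sup>+v. ?h (u, v) \<partial>lborel \<partial>lborel)"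
    by (subst lborel.nn_integral_fst) (simp_all add: lborel_prod)
  also have "\<dots> = (\<integral>\<^sup>+u. ennreal C * (ennreal (\<bar>u\<bar> ^ i * (1 - u\<^sup>2) powr (real j + k2 + k3 + 1/2)) * indicator {-1..1} u) \<partial>lborel)"
  \<comment> \<open>The endpoints, where \<open>1 - u^2 = 0\<close> and the slice formula does not
    apply, form a null set.\<close>
  proof (intro nn_integral_cong_AE AE_I[of _ _ "{-1, 1}"])
    have "(\<integral>\<^sup>+v. ?h (u, v) \<partial>lborel) = ennreal C * (ennreal (\<bar>u\<bar> ^ i * (1 - u\<^sup>2) powr (real j + k2 + k3 + 1/2)) * indicator {-1..1} u)"
      if "u \<noteq> 1" "u \<noteq> -1" for u
    proof (cases "\<bar>u\<bar> < 1")
      case True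
      have [measurable]: "(\<lambda>v. (u, v)) \<in> borel_measurable (borel :: real measure)"
        by (intro borel_measurable_continuous_onI continuous_intros)
      have "(\<integral>\<^sup>+v. ?h (u, v) \<partial>lborel) =
          (\<integral>\<^sup>+v. ennreal (\<bar>u\<bar> ^ i) * ennreal (indicator (Omega a b c) (u, v) * (Wt a b c k2 k3 (u, v) * xi a b c (u, v) ^ j)) \<partial>lborel)"
        by (intro nn_integral_cong) (simp add: ennreal_mult'[symmetric] mult_ac)
      also have "\<dots> = ennreal (\<bar>u\<bar> ^ i) * (\<integral>\<^sup>+v. ennreal (indicator (Omega a b c) (u, v) * (Wt a b c k2 k3 (u, v) * xi a b c (u, v) ^ j)) \<partial>lborel)"
        using \<open>a < b\<close> by (intro nn_integral_cmult) measurable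
      also have "\<dots> = ennreal (\<bar>u\<bar> ^ i) * ennreal ((b - a) * (1 - u\<^sup>2) powr (real j + k2 + k3 + 1/2) * Beta (real j + k2 + 1/2) (k3 + 1))"
        using nn_integral_Wt_slice[OF assms True] by simp
      also have "\<dots> = ennreal C * ennreal (\<bar>u\<bar> ^ i * (1 - u\<^sup>2) powr (real j + k2 + k3 + 1/2))"
        using C by (simp add: ennreal_mult'[symmetric] C_def mult_ac)
      finally have "(\<integral>\<^sup>+v. ?h (u, v) \<partial>lborel) = ennreal C * ennreal (\<bar>u\<bar> ^ i * (1 - u\<^sup>2) powr (real j + k2 + k3 + 1/2))" .
      moreover have "u \<in> {-1..1}" using True by auto
      ultimately show ?thesis by simp
    next
      case False
      then have "(u, v) \<notin> Omega a b c" for v using that by (auto simp: Omega_def)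
      moreover have "u \<notin> {-1..1}" using False that by auto
      ultimately show ?thesis by simp
    qed
    then show "{u \<in> space lborel. (\<integral>\<^sup>+v. ?h (u, v) \<partial>lborel) \<noteq>
        ennreal C * (ennreal (\<bar>u\<bar> ^ i * (1 - u\<^sup>2) powr (real j + k2 + k3 + 1/2)) * indicator {-1..1} u)} \<subseteq> {-1, 1}"
      by blast
  qed (auto simp: emeasure_lborel_countable)
  also have "\<dots> = ennreal C * (\<integral>\<^sup>+u. ennreal (\<bar>u\<bar> ^ i * (1 - u\<^sup>2) powr (real j + k2 + k3 + 1/2)) * indicator {-1..1} u \<partial>lborel)"
    by (rule nn_integral_cmult) measurable
  also have "\<dots> = ennreal C * ennreal (Beta ((real i + 1) / 2) (real j + k2 + k3 + 3/2))"
    using assms nn_integral_abs_power_Beta[of "real j + k2 + k3 + 1/2" i] by (simp add: add.assoc)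
  also have "\<dots> = ennreal (C * Beta ((real i + 1) / 2) (real j + k2 + k3 + 3/2))"
    using C by (simp add: ennreal_mult')
  finally show ?thesis by (simp add: C_def)
qed

section \<open>Symmetry and orthogonality\<close>

lemma Beta_real_nonneg: "x > 0 \<Longrightarrow> y > 0 \<Longrightarrow> Beta x y \<ge> (0 :: real)"
  by (simp add: Beta_def Gamma_real_nonneg)

section \<open>Integration of polynomials in \<open>(s, x)\<close> against the weight\<close>

locale weight_parameters =
  fixes a b c k2 k3 :: real
  assumes a: "0 \<le> a" and ab: "a < b" and c: "0 \<le> c" and k2: "k2 > - 1/2" and k3: "k3 > - 1"
begin

text \<open>Odd powers of \<open>u\<close> get 0 because the domain and the weight are invariant
  under \<open>u \<mapsto> -u\<close>.\<close>

definition moment :: "nat \<Rightarrow> nat \<Rightarrow> real" where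
  "moment i j = (if even i then
     (b - a) * Beta (real j + k2 + 1/2) (k3 + 1) * Beta ((real i + 1) / 2) (real j + k2 + k3 + 3/2) else 0)"

text \<open>With the value as an argument, integrability and value travel together through sums and
  scalar multiples.\<close>

definition has_Wt_integral :: "(real \<times> real \<Rightarrow> real) \<Rightarrow> real \<Rightarrow> bool" where
  "has_Wt_integral H x \<longleftrightarrow> has_bochner_integral lborel
     (\<lambda>p. indicator (Omega a b c) p * (Wt a b c k2 k3 p * H (fst p, xi a b c p))) x"

lemma has_Wt_integral_add: "has_Wt_integral G x \<Longrightarrow> has_Wt_integral H y \<Longrightarrow> has_Wt_integral (\<lambda>p. G p + H p) (x + y)"
  unfolding has_Wt_integral_def by (drule (1) has_bochner_integral_add) (simp add: algebra_simps)

lemma has_Wt_integral_cmult: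
  assumes "has_Wt_integral G x"
  shows "has_Wt_integral (\<lambda>p. d * G p) (d * x)"
proof -
  have "has_bochner_integral lborel
      (\<lambda>p. d * (indicator (Omega a b c) p * (Wt a b c k2 k3 p * G (fst p, xi a b c p)))) (d * x)"
    using assms unfolding has_Wt_integral_def by (intro has_bochner_integral_mult_right) simp
  then show ?thesis unfolding has_Wt_integral_def by (simp only: mult.left_commute[of d])
qed

lemma has_Wt_integral_unique: "has_Wt_integral G x \<Longrightarrow> has_Wt_integral G y \<Longrightarrow> x = y"
  unfolding has_Wt_integral_def by (rule has_bochner_integral_eq)

text \<open>Integrability comes from the absolute moments, the value from the parity of
  \<open>i\<close>.\<close>

lemma has_Wt_integral_power: "has_Wt_integral (\<lambda>p. fst p ^ i * snd p ^ j) (moment i j)"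
proof -
  define h where "h p = indicator (Omega a b c) p * (Wt a b c k2 k3 p * (fst p ^ i * xi a b c p ^ j))" for p
  define C where "C = (b - a) * Beta (real j + k2 + 1/2) (k3 + 1) * Beta ((real i + 1) / 2) (real j + k2 + k3 + 3/2)"
  have C: "C \<ge> 0"
    using k2 k3 ab unfolding C_def by (intro mult_nonneg_nonneg Beta_real_nonneg) auto
  have [measurable]: "fst \<in> borel_measurable (borel :: (real \<times> real) measure)"
    by (intro borel_measurable_continuous_onI continuous_intros)
  have [measurable]: "h \<in> borel_measurable borel"
    using ab unfolding h_def by measurable
  have Wt_nonneg: "Wt a b c k2 k3 p \<ge> 0" for p
    by (simp add: Wt_eq[OF ab])
  have abs_h: "\<bar>h p\<bar> = indicator (Omega a b c) p * (Wt a b c k2 k3 p * (\<bar>fst p\<bar> ^ i * xi a b c p ^ j))" for p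
    using Wt_nonneg[of p] Omega_iff[OF ab, of p c] by (auto simp: h_def indicator_def abs_mult power_abs)
  then have nn: "(\<integral>\<^sup>+p. ennreal \<bar>h p\<bar> \<partial>lborel) = ennreal C"
    using nn_integral_Wt_moment[OF a ab c k2 k3, of i j] by (simp add: C_def)
  have int: "integrable lborel h"
    by (rule integrableI_bounded) (simp_all add: nn)
  show ?thesis
  proof (cases "even i")
    case True
    then have "h p = \<bar>h p\<bar>" for p unfolding abs_h by (simp add: h_def power_even_abs)
    then have "0 \<le> h p" "ennreal (h p) = ennreal \<bar>h p\<bar>" for p by (metis abs_ge_zero, metis)
    then have "has_bochner_integral lborel h C"
      using C nn by (intro has_bochner_integral_nn_integral) auto
    then show ?thesis using True by (simp add: has_Wt_integral_def h_def[abs_def] moment_def C_def)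
  next
    case False
    \<comment> \<open>For odd \<open>i\<close> the inner integral is odd in \<open>u\<close>, so the
      substitution \<open>u \<mapsto> -u\<close> shows that the whole integral equals its own
      negative.\<close>
    define F where "F u = (LINT v|lborel. h (u, v))" for u
    have "h (- u, v) = - h (u, v)" for u v
      using False by (simp add: h_def Wt_def xi_def Omega_def indicator_def)
    then have F: "F (- u) = - F u" for u by (simp add: F_def)
    have "integral\<^sup>L lborel h = (LINT u|lborel. F u)"
      using lborel_pair.integral_fst'[of h] int by (simp add: lborel_prod F_def)
    moreover have "(LINT u|lborel. F u) = - (LINT u|lborel. F u)"
      by (subst lborel_integral_real_affine[of "-1" _ 0]) (simp_all add: F)
    ultimately have "integral\<^sup>L lborel h = 0" by simp
    with int have "has_bochner_integral lborel h 0"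
      by (simp add: has_bochner_integral_iff)
    then show ?thesis using False by (simp add: has_Wt_integral_def h_def[abs_def] moment_def)
  qed
qed

lemma has_Wt_integral_monom: "has_Wt_integral (\<lambda>p. d * fst p ^ i * snd p ^ j) (d * moment i j)"
  using has_Wt_integral_cmult[OF has_Wt_integral_power[of i j], of d] by (simp add: mult.assoc)

lemma wpol_has_Wt_integral:
  assumes "wpol q n H"
  shows "\<exists>x. has_Wt_integral H x"
  using assms
proof induction
  case (monom i j d)
  show ?case using has_Wt_integral_monom by blast
next
  case (add G H)
  then show ?case using has_Wt_integral_add by blast
qed

section \<open>Recursions for the moments and symmetry of the operator\<close>

lemma moment_Suc_Suc:
  "(real i + 2 * real j + 2 * k2 + 2 * k3 + 4) * moment (i + 2) j = (real i + 1) * moment i j"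
proof (cases "even i")
  case True
  define z where "z = (real i + 1) / 2"
  define y where "y = real j + k2 + k3 + 3/2"
  have "z \<notin> \<int>\<^sub>\<le>\<^sub>0" by (auto simp: z_def dest: nonpos_Ints_nonpos)
  \<comment> \<open>Only the second Beta factor depends on \<open>i\<close>; raising
    \<open>i\<close> by 2 raises its first argument \<open>z\<close> by 1.\<close>
  from Beta_plus1_left[OF this, of y] have "2 * (z + y) * Beta (z + 1) y = 2 * z * Beta z y"
    by (simp only: mult.assoc)
  moreover have N: "2 * (z + y) = real i + 2 * real j + 2 * k2 + 2 * k3 + 4" "2 * z = real i + 1"
    and z1: "(real (i + 2) + 1) / 2 = z + 1"
    by (simp_all add: z_def y_def field_simps)
  ultimately have *: "(real i + 2 * real j + 2 * k2 + 2 * k3 + 4) * Beta (z + 1) y = (real i + 1) * Beta z y"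
    by (simp only:)
  have "moment (i + 2) j = (b - a) * Beta (real j + k2 + 1/2) (k3 + 1) * Beta (z + 1) y"
    "moment i j = (b - a) * Beta (real j + k2 + 1/2) (k3 + 1) * Beta z y"
    unfolding moment_def z1 y_def[symmetric] z_def[symmetric] using True by simp_all
  then show ?thesis
    using * by (metis mult.left_commute)
qed (simp add: moment_def)

text \<open>Raising \<open>j\<close> shifts both Beta factors. The factor \<open>x + y\<close> from
  the first cancels against the second, so the factor on the left is the same as in
  \<open>moment_Suc_Suc\<close>.\<close>

lemma moment_Suc_right:
  "(real i + 2 * real j + 2 * k2 + 2 * k3 + 4) * moment i (Suc j) = (2 * real j + 2 * k2 + 1) * moment i j"
proof (cases "even i")
  case True
  define z where "z = (real i + 1) / 2"
  define x where "x = real j + k2 + 1/2"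
  define y where "y = k3 + 1"
  have "x > 0" "y > 0" using k2 k3 by (auto simp: x_def y_def)
  then have "x \<notin> \<int>\<^sub>\<le>\<^sub>0" "x + y \<notin> \<int>\<^sub>\<le>\<^sub>0" by (auto dest: nonpos_Ints_nonpos)
  then have 1: "(x + y) * Beta (x + 1) y = x * Beta x y"
    and 2: "(z + (x + y)) * Beta z (x + y + 1) = (x + y) * Beta z (x + y)"
    by (simp_all add: Beta_plus1_left Beta_plus1_right)
  have "2 * (z + (x + y)) * ((b - a) * Beta (x + 1) y * Beta z (x + y + 1))
      = 2 * (b - a) * Beta (x + 1) y * ((z + (x + y)) * Beta z (x + y + 1))"
    by (simp only: mult_ac)
  also have "\<dots> = 2 * (b - a) * ((x + y) * Beta (x + 1) y) * Beta z (x + y)"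
    unfolding 2 by (simp only: mult_ac)
  also have "\<dots> = 2 * x * ((b - a) * Beta x y * Beta z (x + y))"
    unfolding 1 by (simp only: mult_ac)
  finally have "2 * (z + (x + y)) * ((b - a) * Beta (x + 1) y * Beta z (x + y + 1))
      = 2 * x * ((b - a) * Beta x y * Beta z (x + y))" .
  moreover have "moment i (Suc j) = (b - a) * Beta (x + 1) y * Beta z (x + y + 1)"
    "moment i j = (b - a) * Beta x y * Beta z (x + y)"
    using True by (simp_all add: moment_def x_def y_def z_def add_ac)
  moreover have "2 * (z + (x + y)) = real i + 2 * real j + 2 * k2 + 2 * k3 + 4" "2 * x = 2 * real j + 2 * k2 + 1"
    by (simp_all add: x_def y_def z_def field_simps)
  ultimately show ?thesis by (simp only:)
qed (simp add: moment_def)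

text \<open>Both recursions carry the same factor \<open>N\<close>. Exchanging \<open>(i, j)\<close>
  with \<open>(k, l)\<close> therefore changes the first term by \<open>(i - k) N moment I J\<close>
  and the second by \<open>2 (j - l) N moment I J\<close>, and the eigenvalues differ by exactly
  \<open>((i - k) + 2 (j - l)) N\<close>.\<close>

lemma moment_symmetric:
  fixes i j k l :: nat
  defines "ev \<equiv> \<lambda>m::nat. real m * (real m + 2 * k2 + 2 * k3 + 2)"
  shows "real i * (real i - 1) * moment (i - 2 + k) (j + l) + 2 * real j * (2 * real j - 1 + 2 * k2) * moment (i + k) (j - 1 + l)
      - ev (i + 2 * j) * moment (i + k) (j + l) =
     real k * (real k - 1) * moment (k - 2 + i) (l + j) + 2 * real l * (2 * real l - 1 + 2 * k2) * moment (k + i) (l - 1 + j)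
      - ev (k + 2 * l) * moment (k + i) (l + j)"
proof -
  define I where "I = i + k"
  define J where "J = j + l"
  define N where "N = real I + 2 * real J + 2 * k2 + 2 * k3 + 2"
  \<comment> \<open>For \<open>x < 2\<close> the truncated exponents may differ, but then the
    coefficient vanishes.\<close>
  have red: "real x * (real x - 1) * moment (x - 2 + y) J = real x * (real x - 1) * moment (x + y - 2) J" for x y
    by (cases "x \<ge> 2") (auto simp: not_le less_2_cases_iff)
  \<comment> \<open>Rests on \<open>i (i - 1) - k (k - 1) = (i - k) (I - 1)\<close>.\<close>
  have "real i * (real i - 1) * moment (i - 2 + k) J - real k * (real k - 1) * moment (k - 2 + i) J
      = (real i - real k) * ((real I - 1) * moment (I - 2) J)"
    unfolding red I_def by (simp add: algebra_simps add.commute[of k i])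
  also have "\<dots> = (real i - real k) * (N * moment I J)"
  proof (cases "I \<ge> 2")
    case True
    then obtain I' where "I = I' + 2" by (metis add.commute le_Suc_ex)
    then have "(real I - 1) * moment (I - 2) J = N * moment I J"
      using moment_Suc_Suc[of I' J] by (simp add: N_def algebra_simps)
    then show ?thesis by simp
  next
    case False
    then consider "i = 0" "k = 0" | "I = 1" by (force simp: I_def)
    then show ?thesis by cases (auto simp: moment_def)
  qed
  finally have A: "real i * (real i - 1) * moment (i - 2 + k) J - real k * (real k - 1) * moment (k - 2 + i) J
      = (real i - real k) * (N * moment I J)" .
  have redj: "real x * (2 * real x - 1 + 2 * k2) * moment I (x - 1 + y) = real x * (2 * real x - 1 + 2 * k2) * moment I (x + y - 1)" for x y
    by (cases x) auto
  have "real j * (2 * real j - 1 + 2 * k2) * moment I (j - 1 + l) - real l * (2 * real l - 1 + 2 * k2) * moment I (l - 1 + j)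
      = (real j - real l) * ((2 * real J + 2 * k2 - 1) * moment I (J - 1))"
    unfolding redj J_def by (simp add: algebra_simps add.commute[of l j])
  also have "\<dots> = (real j - real l) * (N * moment I J)"
  proof (cases J)
    case 0
    then show ?thesis by (simp add: J_def)
  next
    case (Suc J')
    then have "(2 * real J + 2 * k2 - 1) * moment I (J - 1) = N * moment I J"
      using moment_Suc_right[of I J'] by (simp add: N_def algebra_simps)
    then show ?thesis by simp
  qed
  finally have B: "real j * (2 * real j - 1 + 2 * k2) * moment I (j - 1 + l) - real l * (2 * real l - 1 + 2 * k2) * moment I (l - 1 + j)
      = (real j - real l) * (N * moment I J)" .
  have E: "ev (i + 2 * j) - ev (k + 2 * l) = ((real i - real k) + 2 * (real j - real l)) * N"
    by (simp add: ev_def N_def I_def J_def algebra_simps)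
  have "ev (i + 2 * j) * moment I J - ev (k + 2 * l) * moment I J = ((real i - real k) + 2 * (real j - real l)) * N * moment I J"
    unfolding E[symmetric] by (simp add: algebra_simps)
  with A B show ?thesis
    unfolding add.commute[of k i] add.commute[of l j] I_def[symmetric] J_def[symmetric]
    by (simp add: algebra_simps)
qed

lemma has_Wt_integral_Dcal_sq_monom:
  "has_Wt_integral (\<lambda>p. Dcal_sq k2 k3 (\<lambda>p. e * fst p ^ i * snd p ^ j) p * (d * fst p ^ k * snd p ^ l))
    (e * d * (real i * (real i - 1) * moment (i - 2 + k) (j + l) + 2 * real j * (2 * real j - 1 + 2 * k2) * moment (i + k) (j - 1 + l)
      - real (i + 2 * j) * (real (i + 2 * j) + 2 * k2 + 2 * k3 + 2) * moment (i + k) (j + l)))"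
proof -
  let ?l = "real (i + 2 * j) * (real (i + 2 * j) + 2 * k2 + 2 * k3 + 2)"
  have "has_Wt_integral (\<lambda>p. (e * d * (real i * (real i - 1))) * fst p ^ (i - 2 + k) * snd p ^ (j + l)
     + ((e * d * (2 * real j * (2 * real j - 1 + 2 * k2))) * fst p ^ (i + k) * snd p ^ (j - 1 + l)
     + (- e * d * ?l) * fst p ^ (i + k) * snd p ^ (j + l)))
    ((e * d * (real i * (real i - 1))) * moment (i - 2 + k) (j + l) +
     ((e * d * (2 * real j * (2 * real j - 1 + 2 * k2))) * moment (i + k) (j - 1 + l) + (- e * d * ?l) * moment (i + k) (j + l)))"
    by (intro has_Wt_integral_add has_Wt_integral_monom)
  then show ?thesis unfolding Dcal_sq_monom power_add by (simp add: algebra_simps)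
qed

text \<open>Linearity in each argument reduces the claim to monomials, where it is
  \<open>moment_symmetric\<close>. Stating a common value \<open>x\<close> lets the claim pass
  through sums.\<close>

lemma has_Wt_integral_Dcal_sq_symmetric:
  assumes "wpol 2 m G" "wpol 2 n H"
  obtains x where "has_Wt_integral (\<lambda>p. Dcal_sq k2 k3 G p * H p) x" "has_Wt_integral (\<lambda>p. G p * Dcal_sq k2 k3 H p) x"
proof -
  have "\<exists>x. has_Wt_integral (\<lambda>p. Dcal_sq k2 k3 G p * H p) x \<and> has_Wt_integral (\<lambda>p. G p * Dcal_sq k2 k3 H p) x"
    using assms
  proof induction
    case (monom i j e)
    from monom(2,1) show ?case
    proof induction
      case (monom k l d)
      show ?case
        using has_Wt_integral_Dcal_sq_monom[of e i j d k l] has_Wt_integral_Dcal_sq_monom[of d k l e i j] moment_symmetric[of i k j l]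
        by (auto simp: mult.commute[of d e] mult.commute[of _ "Dcal_sq k2 k3 (\<lambda>p. d * fst p ^ k * snd p ^ l) _"])
    next
      case (add H H')
      then obtain x y where "has_Wt_integral (\<lambda>p. Dcal_sq k2 k3 (\<lambda>a. e * fst a ^ i * snd a ^ j) p * H p) x"
        "has_Wt_integral (\<lambda>p. e * fst p ^ i * snd p ^ j * Dcal_sq k2 k3 H p) x"
        "has_Wt_integral (\<lambda>p. Dcal_sq k2 k3 (\<lambda>a. e * fst a ^ i * snd a ^ j) p * H' p) y"
        "has_Wt_integral (\<lambda>p. e * fst p ^ i * snd p ^ j * Dcal_sq k2 k3 H' p) y" by blast
      then show ?case unfolding Dcal_sq_add[OF add.hyps] distrib_left by (intro exI[of _ "x + y"] conjI has_Wt_integral_add)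
    qed
  next
    case (add G G')
    then obtain x y where "has_Wt_integral (\<lambda>p. Dcal_sq k2 k3 G p * H p) x" "has_Wt_integral (\<lambda>p. G p * Dcal_sq k2 k3 H p) x"
      "has_Wt_integral (\<lambda>p. Dcal_sq k2 k3 G' p * H p) y" "has_Wt_integral (\<lambda>p. G' p * Dcal_sq k2 k3 H p) y" by blast
    then show ?case unfolding Dcal_sq_add[OF add.hyps] distrib_right by (intro exI[of _ "x + y"] conjI has_Wt_integral_add)
  qed
  then show thesis using that by blast
qed

section \<open>Definiteness of the pairing\<close>

lemma eq_0_on_open_domain_if_Wt_integral_square_0:
  assumes R: "wpol 2 n R" and J: "has_Wt_integral (\<lambda>p. R p * R p) 0"
    and x: "0 < x" "s\<^sup>2 + x < 1"
  shows "R (s, x) = 0"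
proof (rule ccontr)
  assume ne: "R (s, x) \<noteq> 0"
  let ?T = "\<lambda>p. (fst p, xi a b c p)"
  let ?h = "\<lambda>p. indicator (Omega a b c) p * (Wt a b c k2 k3 p * (R (?T p) * R (?T p)))"
  \<comment> \<open>An open set on which the integrand is positive; \<open>0 < snd p\<close> makes
    the factor \<open>|v|\<close> of the weight nonzero.\<close>
  define U where "U = {p. 0 < xi a b c p \<and> (fst p)\<^sup>2 + xi a b c p < 1 \<and> 0 < snd p \<and> R (?T p) \<noteq> 0}"
  have cont: "continuous_on UNIV (xi a b c)" "continuous_on UNIV (\<lambda>p. R (?T p))"
    using wpol_continuous_on[OF wpol_xi] wpol_continuous_on[OF wpol_compose_xi[OF R]] by auto
  have "open U"
    unfolding U_def
    by (intro open_Collect_conj open_Collect_less open_Collect_neq continuous_intros cont)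
  moreover have "U \<noteq> {}"
  proof -
    have s1: "s\<^sup>2 < 1" using x by simp
    \<comment> \<open>Solving \<open>xi a b c (s, v) = x\<close> for \<open>v^2\<close> gives
      \<open>y\<close>.\<close>
    define y where "y = a * (1 - s\<^sup>2) + c * s\<^sup>2 + (b - a) * x"
    have y: "y > 0" unfolding y_def using s1 a c ab x by (intro add_nonneg_pos add_nonneg_nonneg mult_nonneg_nonneg mult_pos_pos) auto
    have "xi a b c (s, sqrt y) = x"
      using y ab by (simp add: xi_def y_def field_simps)
    then have "(s, sqrt y) \<in> U" using x y ne by (simp add: U_def)
    then show ?thesis by blast
  qed
  ultimately have "\<not> negligible U" by (rule open_not_negligible)
  have int: "integrable lborel ?h" "integral\<^sup>L lborel ?h = 0"
    using J by (auto simp: has_Wt_integral_def has_bochner_integral_iff)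
  have "?h p \<ge> 0" for p by (simp add: Wt_eq[OF ab])
  then have "AE p in lborel. ?h p = 0"
    using integral_nonneg_eq_0_iff_AE[OF int(1)] int(2) by simp
  then obtain N where N: "{p \<in> space lborel. \<not> ?h p = 0} \<subseteq> N" "N \<in> null_sets lborel"
    by (auto simp: eventually_ae_filter)
  have "?h p \<noteq> 0" if "p \<in> U" for p
  proof -
    have "(fst p)\<^sup>2 < 1" "0 \<le> (fst p)\<^sup>2" using that by (auto simp: U_def)
    then have "p \<in> Omega a b c" using that by (auto simp: U_def Omega_iff[OF ab] abs_square_less_1)
    then show ?thesis using that by (simp add: U_def Wt_eq[OF ab])
  qed
  then have "U \<subseteq> N" using N by auto
  moreover have "negligible N"
    using N(2) by (simp add: negligible_iff_null_sets null_sets_completionI)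
  ultimately show False using \<open>\<not> negligible U\<close> negligible_subset by blast
qed

lemma eq_0_on_domain_if_Wt_integral_square_0:
  assumes R: "wpol 2 n R" and J: "has_Wt_integral (\<lambda>p. R p * R p) 0"
    and x: "0 \<le> x" "s\<^sup>2 + x \<le> 1"
  shows "R (s, x) = 0"
proof -
  \<comment> \<open>\<open>R\<close> along the segment from \<open>(s, x)\<close> at
    \<open>t = 0\<close> to the interior point \<open>(0, 1/2)\<close> at \<open>t = 1\<close>. For
    \<open>0 < t < 1\<close> it runs in the open region, so continuity carries the zero to the
    boundary.\<close>
  define g where "g t = R ((1 - t) * s, (1 - t) * x + t / 2)" for t :: real
  have "continuous_on UNIV g"
    unfolding g_def by (intro continuous_on_compose2[OF wpol_continuous_on[OF R, of UNIV]] continuous_intros) auto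
  then have "(g \<longlongrightarrow> g 0) (at_right 0)"
    by (simp add: continuous_on_eq_continuous_within continuous_within filterlim_at_split)
  moreover have "g t = 0" if "0 < t" "t < 1" for t
    unfolding g_def
  proof (rule eq_0_on_open_domain_if_Wt_integral_square_0[OF R J])
    show "0 < (1 - t) * x + t / 2" using that x by (simp add: add_nonneg_pos)
    have "((1 - t) * s)\<^sup>2 = (1 - t) * ((1 - t) * s\<^sup>2)" by (simp add: power2_eq_square)
    also have "\<dots> \<le> (1 - t) * (1 * s\<^sup>2)" using that by (intro mult_left_mono mult_right_mono) auto
    finally have "((1 - t) * s)\<^sup>2 + (1 - t) * x \<le> (1 - t) * (s\<^sup>2 + x)" by (simp add: algebra_simps)
    also have "\<dots> \<le> (1 - t) * 1" using that x by (intro mult_left_mono) auto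
    finally show "((1 - t) * s)\<^sup>2 + ((1 - t) * x + t / 2) < 1" using that by simp
  qed
  then have "eventually (\<lambda>t. g t = 0) (at_right 0)"
    unfolding eventually_at_right_field by (intro exI[of _ 1]) simp
  then have "(g \<longlongrightarrow> 0) (at_right 0)"
    by (rule tendsto_eventually)
  ultimately have "g 0 = 0"
    by (intro tendsto_unique[of "at_right (0::real)" g]) auto
  then show ?thesis by (simp add: g_def)
qed

section \<open>The eigenvalue equation\<close>

lemma VE_orthogonal:
  assumes Y: "Y \<in> VE a b c k2 k3 n" and G: "wpol 2 n G" "\<And>p. Y p = G (fst p, xi a b c p)"
    and n: "n > 0" and H: "wpol 2 (n - 1) H"
  shows "has_Wt_integral (\<lambda>p. G p * H p) 0"
proof -
  obtain x where x: "has_Wt_integral (\<lambda>p. G p * H p) x"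
    using wpol_has_Wt_integral[OF wpol_mult[OF G(1) H]] by blast
  let ?T = "\<lambda>p. (fst p, xi a b c p)"
  let ?h = "\<lambda>p. indicator (Omega a b c) p * (Wt a b c k2 k3 p * (G (?T p) * H (?T p)))"
  have "has_bochner_integral lborel ?h x" using x by (simp add: has_Wt_integral_def)
  \<comment> \<open>\<open>VE\<close> is stated with the gauge integral, which agrees with the
    Lebesgue integral because the integrand is Lebesgue integrable.\<close>
  then have "(?h has_integral x) UNIV"
    using has_integral_integral_lborel[of ?h] by (simp add: has_bochner_integral_iff)
  then have "integral UNIV ?h = x" by (rule integral_unique)
  moreover have "integral UNIV ?h = integral (Omega a b c) (\<lambda>p. Wt a b c k2 k3 p * Y p * H (?T p))"
    unfolding integral_restrict_UNIV[of "Omega a b c", symmetric]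
    by (rule arg_cong[where f = "integral UNIV"]) (auto simp: G(2))
  \<comment> \<open>Pulled back to \<open>(u, v)\<close>, \<open>H\<close> still has degree at most
    \<open>n - 1\<close> and is an admissible test polynomial.\<close>
  moreover have "poly2_le (n - 1) (\<lambda>p. H (?T p))"
    using wpol_compose_xi[OF H] by (simp add: poly2_le_iff_wpol)
  then have "integral (Omega a b c) (\<lambda>p. Wt a b c k2 k3 p * Y p * H (?T p)) = 0"
    using Y n by (auto simp: VE_def)
  ultimately show ?thesis using x by simp
qed

text \<open>For the case \<open>n = 0\<close>, where \<open>n - 1 = n\<close> gives no drop in
  degree and \<open>VE\<close> gives no orthogonality.\<close>

lemma Dcal_sq_wpol_0: "wpol 2 0 G \<Longrightarrow> Dcal_sq k2 k3 G = (\<lambda>p. 0)"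
proof (induction rule: wpol.induct)
  case (add G H)
  then show ?case using Dcal_sq_add[OF add.hyps] by simp
next
  case (monom i j d)
  then have "i = 0" "j = 0" by auto
  then show ?case unfolding Dcal_sq_monom by simp
qed

lemma VE_eigenfunction:
  assumes Y: "Y \<in> VE a b c k2 k3 n" and uv: "(u, v) \<in> Omega a b c" "v \<noteq> 0"
  shows "Dfrak a b c k2 k3 Y (u, v) = - (real n * (real n + 2 * k2 + 2 * k3 + 2)) * Y (u, v)"
proof -
  have "wpol 1 n Y" "Y (u, - v) = Y (u, v)" for u v
    using Y by (auto simp: VE_def poly2_le_iff_wpol)
  then obtain G where G: "wpol 2 n G" and Y_eq: "\<And>p. Y p = G (fst p, xi a b c p)"
    using even_wpol_factors_through_xi[of n Y a b c] ab by blast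
  define ev where "ev = real n * (real n + 2 * k2 + 2 * k3 + 2)"
  define R where "R p = Dcal_sq k2 k3 G p + ev * G p" for p
  have "R (u, xi a b c (u, v)) = 0"
  proof (cases "n = 0")
    case True
    then show ?thesis using Dcal_sq_wpol_0 G by (simp add: R_def ev_def)
  next
    case False
    have R: "wpol 2 (n - 1) R"
      using wpol_Dcal_sq_eigen[OF G, of k2 k3] by (simp add: R_def[abs_def] ev_def)
    have GR: "has_Wt_integral (\<lambda>p. G p * R p) 0"
      using VE_orthogonal[OF Y G Y_eq _ R] False by simp
    \<comment> \<open>\<open>Dcal_sq\<close> does not raise the degree, so it maps \<open>R\<close>
      to a test polynomial again.\<close>
    have GLR: "has_Wt_integral (\<lambda>p. G p * Dcal_sq k2 k3 R p) 0"
      using VE_orthogonal[OF Y G Y_eq _ wpol_Dcal_sq[OF R]] False by simp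
    obtain x where "has_Wt_integral (\<lambda>p. Dcal_sq k2 k3 G p * R p) x" "has_Wt_integral (\<lambda>p. G p * Dcal_sq k2 k3 R p) x"
      using has_Wt_integral_Dcal_sq_symmetric[OF G R] .
    with GLR have "has_Wt_integral (\<lambda>p. Dcal_sq k2 k3 G p * R p) 0" using has_Wt_integral_unique by blast
    \<comment> \<open>One factor of \<open>R * R\<close> is expanded into
      \<open>Dcal_sq k2 k3 G + ev * G\<close>; both resulting pairings with \<open>R\<close> are
      zero.\<close>
    from has_Wt_integral_add[OF this has_Wt_integral_cmult[OF GR, of ev]]
    have "has_Wt_integral (\<lambda>p. R p * R p) 0"
      by (simp add: R_def[abs_def] algebra_simps)
    \<comment> \<open>All of \<open>Omega\<close> is covered, since the vanishing of
      \<open>R\<close> includes the boundary of the region.\<close>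
    then show ?thesis
      using eq_0_on_domain_if_Wt_integral_square_0[OF R] uv by (simp add: Omega_iff[OF ab])
  qed
  moreover have "Dfrak a b c k2 k3 Y (u, v) = Dcal_sq k2 k3 G (u, xi a b c (u, v))"
    using Dfrak_compose_xi[OF G ab uv(2)] by (simp add: Y_eq[abs_def])
  ultimately show ?thesis by (simp add: Y_eq R_def ev_def)
qed

end

theorem theorem3p4:
  fixes a b c k2 k3 :: real and n :: nat
  assumes "0 \<le> a" and "a < b" and "0 \<le> c"
    and "k2 > - 1/2" and "k3 > - 1"
  shows "(\<forall>Y \<in> VE a b c k2 k3 n. \<forall>u v. (u, v) \<in> Omega a b c \<and> v \<noteq> 0 \<longrightarrow>
            Dfrak a b c k2 k3 Y (u, v) = - (real n * (real n + 2 * k2 + 2 * k3 + 2)) * Y (u, v))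
       \<and> (\<forall>f. C2_on (interior upper_half_disk) f \<longrightarrow>
            (\<forall>p \<in> interior (Lambda a b c).
               Dfrak a b c k2 k3 (f \<circ> psi a b c) p = Dcal k2 k3 f (psi a b c p)))"
proof -
  interpret weight_parameters a b c k2 k3
    using assms by unfold_locales auto
  show ?thesis
    using VE_eigenfunction Dfrak_psi_eq_Dcal[OF \<open>a < b\<close>] by blast
qed

end
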